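(* Let $i\in\{3\frac{1}{2},4,5\}$, or let $i=6$ and assume Martin's Axiom together with the negation of the Continuum Hypothesis. A locally connected pseudocompact $T_i$-space $X$ has a pseudocompact $T_i$ one-point connectification if and only if $X$ has no compact component.
   Context: Conventions: $T_{3\frac12}$ = completely regular and $T_1$; $T_4$ = normal and $T_1$; $T_5$ = hereditarily normal (every subspace normal) and $T_1$; $T_6$ = perfectly normal, i.e. normal, $T_1$, and every closed subset is a $G_\delta$-set. A space is pseudocompact if every continuous real-valued function on it is bounded. A one-point connectification of a space $X$ is a connected space $Y$ which contains $X$ as a dense subspace and such that $Y\setminus X$ is a singleton. *)

theory Defs
  imports "HOL-Analysis.Analysis" "HOL-Library.Equipollence"
begin

datatype sep_axiom = T3half | T4 | T5 | T6

definition hereditarily_normal_space :: "'a topology \<Rightarrow> bool" where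
  "hereditarily_normal_space X \<longleftrightarrow> (\<forall>S. S \<subseteq> topspace X \<longrightarrow> normal_space (subtopology X S))"

definition perfectly_normal_space :: "'a topology \<Rightarrow> bool" where
  "perfectly_normal_space X \<longleftrightarrow> normal_space X \<and> (\<forall>C. closedin X C \<longrightarrow> gdelta_in X C)"

fun T_space :: "sep_axiom \<Rightarrow> 'a topology \<Rightarrow> bool" where
  "T_space T3half X = (completely_regular_space X \<and> t1_space X)"
| "T_space T4 X = (normal_space X \<and> t1_space X)"
| "T_space T5 X = (hereditarily_normal_space X \<and> t1_space X)"
| "T_space T6 X = (perfectly_normal_space X \<and> t1_space X)"

definition pseudocompact_space :: "'a topology \<Rightarrow> bool" where
  "pseudocompact_space X \<longleftrightarrow>
     (\<forall>f. continuous_map X euclideanreal f \<longrightarrow> bounded (f ` topspace X))"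

text \<open>One-point connectification: a connected space Y containing (an embedded copy of)
  X as a dense subspace with exactly one extra point. Since Y minus X is a single point,
  Y can be taken without loss of generality on the type 'a option, with X embedded via Some.\<close>
definition one_point_connectification :: "'a topology \<Rightarrow> 'a option topology \<Rightarrow> bool" where
  "one_point_connectification X Y \<longleftrightarrow>
     connected_space Y \<and> embedding_map X Y Some \<and>
     Y closure_of (Some ` topspace X) = topspace Y \<and>
     (\<exists>p. topspace Y - Some ` topspace X = {p})"

text \<open>Martin's Axiom. Forcing convention: le p q means p is stronger than q.
  It suffices to consider posets of cardinality at most the continuum, so we take
  carriers that are subsets of the reals.\<close>
definition ma_compatible :: "real set \<Rightarrow> (real \<Rightarrow> real \<Rightarrow> bool) \<Rightarrow> real \<Rightarrow> real \<Rightarrow> bool" where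
  "ma_compatible P le p q \<longleftrightarrow> (\<exists>r\<in>P. le r p \<and> le r q)"

definition ma_ccc :: "real set \<Rightarrow> (real \<Rightarrow> real \<Rightarrow> bool) \<Rightarrow> bool" where
  "ma_ccc P le \<longleftrightarrow> (\<forall>A. A \<subseteq> P \<and> (\<forall>p\<in>A. \<forall>q\<in>A. p \<noteq> q \<longrightarrow> \<not> ma_compatible P le p q)
                      \<longrightarrow> countable A)"

definition ma_dense :: "real set \<Rightarrow> (real \<Rightarrow> real \<Rightarrow> bool) \<Rightarrow> real set \<Rightarrow> bool" where
  "ma_dense P le D \<longleftrightarrow> D \<subseteq> P \<and> (\<forall>p\<in>P. \<exists>d\<in>D. le d p)"

definition ma_filter :: "real set \<Rightarrow> (real \<Rightarrow> real \<Rightarrow> bool) \<Rightarrow> real set \<Rightarrow> bool" where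
  "ma_filter P le G \<longleftrightarrow> G \<subseteq> P \<and> G \<noteq> {} \<and>
     (\<forall>p\<in>G. \<forall>q\<in>P. le p q \<longrightarrow> q \<in> G) \<and>
     (\<forall>p\<in>G. \<forall>q\<in>G. \<exists>r\<in>G. le r p \<and> le r q)"

definition partial_order_on_set :: "real set \<Rightarrow> (real \<Rightarrow> real \<Rightarrow> bool) \<Rightarrow> bool" where
  "partial_order_on_set P le \<longleftrightarrow>
     (\<forall>p\<in>P. le p p) \<and>
     (\<forall>p\<in>P. \<forall>q\<in>P. le p q \<and> le q p \<longrightarrow> p = q) \<and>
     (\<forall>p\<in>P. \<forall>q\<in>P. \<forall>r\<in>P. le p q \<and> le q r \<longrightarrow> le p r)"

definition martins_axiom :: bool where
  "martins_axiom \<longleftrightarrow>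
     (\<forall>P le \<D>. P \<noteq> {} \<and> partial_order_on_set P le \<and> ma_ccc P le \<and>
        (\<forall>D\<in>\<D>. ma_dense P le D) \<and> \<D> \<prec> (UNIV :: real set)
        \<longrightarrow> (\<exists>G. ma_filter P le G \<and> (\<forall>D\<in>\<D>. G \<inter> D \<noteq> {})))"

definition continuum_hypothesis :: bool where
  "continuum_hypothesis \<longleftrightarrow>
     (\<forall>A :: real set. uncountable A \<longrightarrow> A \<approx> (UNIV :: real set))"

end

theory Submission
  imports Defs
begin

text \<open>A compact component of \<open>X\<close> is clopen in every Hausdorff one-point connectification, which is
  impossible. Conversely, choose for each (clopen, noncompact) component an open cover without finite
  subcover. The sets that meet every component in a finitely covered set form an ideal \<open>\<O>\<close>, and the
  complements of its members generate the neighbourhoods of a new point, up to functional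
  separation. The resulting space is completely regular; it is connected because no member of \<open>\<O>\<close>
  contains a component. Adding one point to a (hereditarily) normal space preserves (hereditary)
  normality as soon as the extension is regular.

  For \<open>i = 6\<close> both sides fail: by a theorem of Weiss, Martin's Axiom and the failure of CH make every
  perfectly normal countably compact space compact. In such a space discrete subsets are countable.
  If it is not compact, it contains a closed \<open>E\<close> covered by \<open>\<omega>\<^sub>1\<close> open sets, no countably many of which
  suffice. If closures of countable subsets of \<open>E\<close> were always countably covered, recursion would give
  an uncountable discrete subset; otherwise some countable \<open>D \<subseteq> E\<close> has a closure that is not countably
  covered, and Martin's Axiom yields an infinite subset of \<open>D\<close> without accumulation point.\<close>

section \<open>Adding one point\<close>

text \<open>At most one of two disjoint closed sets contains \<open>p\<close>. Normality off
  \<open>p\<close> separates their traces there, and regularity at \<open>p\<close> allows the two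
  open sets to be corrected near that point.\<close>

lemma normal_space_one_point:
  assumes reg: "regular_space Y" and p: "closedin Y {p}"
    and norm: "normal_space (subtopology Y (topspace Y - {p}))"
  shows "normal_space Y"
proof -
  let ?M = "topspace Y - {p}"
  have M: "openin Y ?M"
    using p by blast
  have sep: "\<exists>U V. openin Y U \<and> openin Y V \<and> A \<subseteq> U \<and> B \<subseteq> V \<and> disjnt U V"
    if A: "closedin Y A" and B: "closedin Y B" and AB: "disjnt A B" and pB: "p \<notin> B" for A B
  proof -
    have "closedin (subtopology Y ?M) (A \<inter> ?M)" "closedin (subtopology Y ?M) (B \<inter> ?M)"
      using A B closedin_subtopology by blast+
    moreover have "disjnt (A \<inter> ?M) (B \<inter> ?M)"
      using AB by (auto simp: disjnt_def)
    ultimately obtain U V where UV: "openin (subtopology Y ?M) U" "openin (subtopology Y ?M) V"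
        "A \<inter> ?M \<subseteq> U" "B \<inter> ?M \<subseteq> V" "disjnt U V"
      using norm unfolding normal_space_def by meson
    have U: "openin Y U" "openin Y V"
      using UV M openin_trans_full by blast+
    have "p \<in> topspace Y - B"
      using p pB closedin_subset by fastforce
    then obtain U' V' where UV': "openin Y U'" "openin Y V'" "p \<in> U'" "B \<subseteq> V'" "disjnt U' V'"
      using reg B unfolding regular_space_def by meson
    \<comment> \<open>\<open>U'\<close> supplies the point \<open>p\<close> that \<open>U\<close>
      may miss; cutting \<open>V\<close> down by \<open>V'\<close> restores disjointness.\<close>
    have "A \<subseteq> U \<union> U'" "B \<subseteq> V \<inter> V'"
      using UV UV' A B pB closedin_subset by blast+
    moreover have "disjnt (U \<union> U') (V \<inter> V')"
      using UV UV' by (auto simp: disjnt_def)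
    ultimately show ?thesis
      using U UV' by (meson openin_Un openin_Int)
  qed
  show ?thesis
    unfolding normal_space_def
  proof (intro allI impI, elim conjE)
    fix A B
    assume A: "closedin Y A" and B: "closedin Y B" and AB: "disjnt A B"
    show "\<exists>U V. openin Y U \<and> openin Y V \<and> A \<subseteq> U \<and> B \<subseteq> V \<and> disjnt U V"
    proof (cases "p \<in> B")
      case True
      then have "p \<notin> A"
        using AB by (auto simp: disjnt_def)
      then obtain U V where "openin Y U" "openin Y V" "B \<subseteq> U" "A \<subseteq> V" "disjnt U V"
        using sep[OF B A] AB disjnt_sym by meson
      then show ?thesis
        using disjnt_sym by blast
    qed (use sep[OF A B AB] in simp)
  qed
qed

text \<open>A subspace avoiding \<open>p\<close> is normal by assumption. One containing
  \<open>p\<close> is regular with \<open>{p}\<close> closed in it, so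
  \<open>normal_space_one_point\<close> applies inside the subspace.\<close>

lemma hereditarily_normal_space_one_point:
  assumes reg: "regular_space Y" and t1: "t1_space Y"
    and norm: "hereditarily_normal_space (subtopology Y (topspace Y - {p}))"
  shows "hereditarily_normal_space Y"
  unfolding hereditarily_normal_space_def
proof (intro allI impI)
  fix S
  assume S: "S \<subseteq> topspace Y"
  have *: "normal_space (subtopology Y (S - {p}))"
  proof -
    have "S - {p} \<subseteq> topspace (subtopology Y (topspace Y - {p}))"
      using S by auto
    then have "normal_space (subtopology (subtopology Y (topspace Y - {p})) (S - {p}))"
      using norm unfolding hereditarily_normal_space_def by blast
    moreover have "(topspace Y - {p}) \<inter> (S - {p}) = S - {p}"
      using S by blast
    ultimately show ?thesis
      by (simp add: subtopology_subtopology)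
  qed
  show "normal_space (subtopology Y S)"
  proof (cases "p \<in> S")
    case True
    show ?thesis
    proof (rule normal_space_one_point)
      show "regular_space (subtopology Y S)"
        using reg by (rule regular_space_subtopology)
      show "closedin (subtopology Y S) {p}"
        using t1_space_subtopology[OF t1, of S] True S
        by (simp add: t1_space_closedin_singleton Int_absorb1)
      show "normal_space (subtopology (subtopology Y S) (topspace (subtopology Y S) - {p}))"
        using * S by (simp add: subtopology_subtopology Int_absorb1 Int_Diff Int_absorb2)
    qed
  next
    case False
    then show ?thesis
      using * by simp
  qed
qed

section \<open>The one-point extension determined by a directed cover\<close>

text \<open>A neighbourhood of the new point is a set whose complement is functionally separated from the
  complement of some member of \<open>\<O>\<close>.\<close>

definition one_point_topology :: "'a topology \<Rightarrow> 'a set set \<Rightarrow> 'a option topology" where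
  "one_point_topology X \<O> = topology (\<lambda>W. W \<subseteq> insert None (Some ` topspace X) \<and>
     openin X (Some -` W) \<and>
     (None \<in> W \<longrightarrow> (\<exists>A\<in>\<O>. \<exists>f. continuous_map X euclideanreal f \<and>
        (\<forall>x\<in>topspace X - A. f x = 1) \<and> (\<forall>x\<in>topspace X. Some x \<notin> W \<longrightarrow> f x = 0))))"

text \<open>\<open>Un_closed\<close> lets neighbourhoods of \<open>None\<close> be intersected,
  \<open>ex_member\<close> makes the whole extension open, and \<open>covers\<close> keeps
  \<open>None\<close> apart from the points of \<open>X\<close>. Not every member has to be open:
  \<open>covers\<close> only asks for an open member around each point.\<close>

locale directed_open_cover =
  fixes X :: "'a topology" and \<O> :: "'a set set"
  assumes ex_member: "\<O> \<noteq> {}"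
    and Un_closed: "A \<in> \<O> \<Longrightarrow> B \<in> \<O> \<Longrightarrow> A \<union> B \<in> \<O>"
    and covers: "x \<in> topspace X \<Longrightarrow> \<exists>A\<in>\<O>. openin X A \<and> x \<in> A"
begin

abbreviation Y :: "'a option topology" where
  "Y \<equiv> one_point_topology X \<O>"

lemma openin_one_point_topology:
  "openin Y W \<longleftrightarrow> W \<subseteq> insert None (Some ` topspace X) \<and>
     openin X (Some -` W) \<and>
     (None \<in> W \<longrightarrow> (\<exists>A\<in>\<O>. \<exists>f. continuous_map X euclideanreal f \<and>
        (\<forall>x\<in>topspace X - A. f x = 1) \<and> (\<forall>x\<in>topspace X. Some x \<notin> W \<longrightarrow> f x = 0)))"
proof -
  let ?P = "\<lambda>W. W \<subseteq> insert None (Some ` topspace X) \<and>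
     openin X (Some -` W) \<and>
     (None \<in> W \<longrightarrow> (\<exists>A\<in>\<O>. \<exists>f. continuous_map X euclideanreal f \<and>
        (\<forall>x\<in>topspace X - A. f x = 1) \<and> (\<forall>x\<in>topspace X. Some x \<notin> W \<longrightarrow> f x = 0)))"
  have "istopology ?P"
    unfolding istopology_def
  proof (intro conjI allI impI)
    fix S T
    assume S: "?P S" and T: "?P T"
    show "S \<inter> T \<subseteq> insert None (Some ` topspace X)"
      using S by blast
    show "openin X (Some -` (S \<inter> T))"
      using S T by auto
    assume "None \<in> S \<inter> T"
    then obtain A f B g where A: "A \<in> \<O>" "continuous_map X euclideanreal f"
        "\<forall>x\<in>topspace X - A. f x = 1" "\<forall>x\<in>topspace X. Some x \<notin> S \<longrightarrow> f x = 0"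
      and B: "B \<in> \<O>" "continuous_map X euclideanreal g"
        "\<forall>x\<in>topspace X - B. g x = 1" "\<forall>x\<in>topspace X. Some x \<notin> T \<longrightarrow> g x = 0"
      using S T by auto
    show "\<exists>A\<in>\<O>. \<exists>f. continuous_map X euclideanreal f \<and>
        (\<forall>x\<in>topspace X - A. f x = 1) \<and> (\<forall>x\<in>topspace X. Some x \<notin> S \<inter> T \<longrightarrow> f x = 0)"
    proof (intro bexI exI conjI)
      show "A \<union> B \<in> \<O>"
        using A B Un_closed by blast
      \<comment> \<open>The product is 1 off \<open>A \<union> B\<close> and vanishes wherever one
        factor does, that is, off \<open>S \<inter> T\<close>.\<close>
      show "continuous_map X euclideanreal (\<lambda>x. f x * g x)"
        using A(2) B(2) by (rule continuous_map_real_mult)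
      show "\<forall>x\<in>topspace X - (A \<union> B). f x * g x = 1"
        using A(3) B(3) by simp
      show "\<forall>x\<in>topspace X. Some x \<notin> S \<inter> T \<longrightarrow> f x * g x = 0"
        using A(4) B(4) by (metis IntI mult_eq_0_iff)
    qed
  next
    fix \<K>
    assume K: "\<forall>S\<in>\<K>. ?P S"
    have "S \<subseteq> insert None (Some ` topspace X)" if "S \<in> \<K>" for S
      using K that by meson
    then show "\<Union>\<K> \<subseteq> insert None (Some ` topspace X)"
      by (rule Union_least)
    have "openin X (Some -` S)" if "S \<in> \<K>" for S
      using K that by meson
    then show "openin X (Some -` \<Union>\<K>)"
      unfolding vimage_Union by blast
    assume "None \<in> \<Union>\<K>"
    then obtain S where S: "S \<in> \<K>" "None \<in> S"
      by blast
    then obtain A f where "A \<in> \<O>" "continuous_map X euclideanreal f"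
        "\<forall>x\<in>topspace X - A. f x = 1" "\<forall>x\<in>topspace X. Some x \<notin> S \<longrightarrow> f x = 0"
      using K by meson
    \<comment> \<open>A witness for one set containing \<open>None\<close> serves for the union,
      since fewer points lie outside the union.\<close>
    then show "\<exists>A\<in>\<O>. \<exists>f. continuous_map X euclideanreal f \<and>
        (\<forall>x\<in>topspace X - A. f x = 1) \<and> (\<forall>x\<in>topspace X. Some x \<notin> \<Union>\<K> \<longrightarrow> f x = 0)"
      using S by (metis UnionI)
  qed
  then show ?thesis
    unfolding one_point_topology_def by (simp add: topology_inverse')
qed

lemma topspace_one_point_topology: "topspace Y = insert None (Some ` topspace X)"
proof -
  have "openin Y (insert None (Some ` topspace X))"
  proof -
    obtain A where A: "A \<in> \<O>"
      using ex_member by blast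
    have "continuous_map X euclideanreal (\<lambda>x. 1) \<and> (\<forall>x\<in>topspace X - A. (1::real) = 1) \<and>
        (\<forall>x\<in>topspace X. Some x \<notin> insert None (Some ` topspace X) \<longrightarrow> (1::real) = 0)"
      by simp
    moreover have "Some -` insert None (Some ` topspace X) = topspace X"
      by auto
    ultimately show ?thesis
      unfolding openin_one_point_topology using A by (metis openin_topspace order_refl)
  qed
  then show ?thesis
    using openin_one_point_topology[of "topspace Y"] openin_subset[of Y] by auto
qed

lemma openin_one_point_topology_Some: "openin Y (Some ` U) \<longleftrightarrow> openin X U"
proof -
  have "Some -` Some ` U = U"
    by auto
  then show ?thesis
    unfolding openin_one_point_topology using openin_subset[of X U] by auto
qed

lemma continuous_map_Some: "continuous_map X Y Some"
  unfolding continuous_map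
proof (intro conjI allI impI)
  fix W
  assume "openin Y W"
  then have W: "openin X (Some -` W)"
    by (simp add: openin_one_point_topology)
  then have "{x \<in> topspace X. Some x \<in> W} = Some -` W"
    using openin_subset by fastforce
  then show "openin X {x \<in> topspace X. Some x \<in> W}"
    using W by simp
qed (auto simp: topspace_one_point_topology)

lemma embedding_map_Some: "embedding_map X Y Some"
  by (rule injective_open_imp_embedding_map)
    (auto simp: continuous_map_Some open_map_def openin_one_point_topology_Some)

text \<open>Off \<open>A\<close> the function already has its value at \<open>None\<close>, so a
  cut-off of the distance to \<open>h None\<close> shows that preimages are neighbourhoods of
  \<open>None\<close>. Functions on the extension are built with this criterion.\<close>

lemma continuous_map_one_point_topology:
  assumes f: "continuous_map X euclideanreal (\<lambda>x. h (Some x))"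
    and A: "A \<in> \<O>" and c: "\<And>x. x \<in> topspace X - A \<Longrightarrow> h (Some x) = h None"
  shows "continuous_map Y euclideanreal h"
  unfolding continuous_map
proof (intro conjI allI impI)
  fix V :: "real set"
  assume V: "openin euclideanreal V"
  let ?W = "{y \<in> topspace Y. h y \<in> V}"
  show "openin Y ?W"
    unfolding openin_one_point_topology
  proof (intro conjI impI)
    have "Some -` ?W = {x \<in> topspace X. h (Some x) \<in> V}"
      by (auto simp: topspace_one_point_topology)
    then show "openin X (Some -` ?W)"
      using f V by (auto simp: continuous_map)
    assume "None \<in> ?W"
    then have "h None \<in> V" "open V"
      using V by simp_all
    then obtain e where e: "e > 0" "ball (h None) e \<subseteq> V"
      using open_contains_ball by blast
    have *: "e \<le> \<bar>h (Some x) - h None\<bar>" if "x \<in> topspace X" "Some x \<notin> ?W" for x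
    proof -
      have "h (Some x) \<notin> V"
        using that by (simp add: topspace_one_point_topology)
      then have "h (Some x) \<notin> ball (h None) e"
        using e(2) by blast
      then show ?thesis
        by (simp add: dist_real_def abs_minus_commute)
    qed
    \<comment> \<open>This is 1 where \<open>h\<close> equals \<open>h None\<close>, in particular
      off \<open>A\<close>, and 0 where \<open>h\<close> is at least \<open>e\<close> away from
      it.\<close>
    let ?g = "\<lambda>x. max 0 (1 - \<bar>h (Some x) - h None\<bar> / e)"
    show "\<exists>A\<in>\<O>. \<exists>g. continuous_map X euclideanreal g \<and>
        (\<forall>x\<in>topspace X - A. g x = 1) \<and> (\<forall>x\<in>topspace X. Some x \<notin> ?W \<longrightarrow> g x = 0)"
    proof (intro bexI exI conjI)
      show "continuous_map X euclideanreal ?g"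
        using f e by (intro continuous_intros) simp_all
      show "\<forall>x\<in>topspace X. Some x \<notin> ?W \<longrightarrow> ?g x = 0"
      proof (intro ballI impI)
        fix x
        assume "x \<in> topspace X" "Some x \<notin> ?W"
        then have "1 \<le> \<bar>h (Some x) - h None\<bar> / e"
          using * e(1) by (simp add: le_divide_eq)
        then show "?g x = 0"
          by simp
      qed
      show "\<forall>x\<in>topspace X - A. ?g x = 1"
        using c by simp
    qed (fact A)
  qed (auto simp: topspace_one_point_topology)
qed auto

text \<open>At \<open>None\<close>, the function \<open>f\<close> from the description of
  neighbourhoods separates after being reversed to \<open>1 - f\<close>. At a point of
  \<open>X\<close>, complete regularity gives a function that is 1 off an open member of
  \<open>\<O>\<close>, so it extends by the value 1.\<close>

lemma completely_regular_separation:
  assumes cr: "completely_regular_space X" and W: "openin Y W" and y: "y \<in> W"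
  shows "\<exists>h. continuous_map Y euclideanreal h \<and> h y = 0 \<and> h ` (topspace Y - W) \<subseteq> {1}"
proof (cases y)
  case None
  then obtain A f where A: "A \<in> \<O>" and f: "continuous_map X euclideanreal f"
    "\<forall>x\<in>topspace X - A. f x = 1" "\<forall>x\<in>topspace X. Some x \<notin> W \<longrightarrow> f x = 0"
    using W y unfolding openin_one_point_topology by auto
  let ?h = "case_option 0 (\<lambda>x. 1 - f x)"
  have "continuous_map Y euclideanreal ?h"
  proof (rule continuous_map_one_point_topology)
    show "continuous_map X euclideanreal (\<lambda>x. ?h (Some x))"
      unfolding option.case using f by (intro continuous_intros) auto
  qed (use A f in auto)
  moreover have "?h ` (topspace Y - W) \<subseteq> {1}"
    using f y None by (auto simp: topspace_one_point_topology)
  ultimately show ?thesis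
    using None by (intro exI[of _ ?h]) simp
next
  case (Some x)
  have W': "openin X (Some -` W)"
    using W by (simp add: openin_one_point_topology)
  have x: "x \<in> topspace X"
    using openin_subset[OF W'] Some y by auto
  then obtain A where A: "A \<in> \<O>" "openin X A" "x \<in> A"
    using covers by blast
  let ?U = "A \<inter> Some -` W"
  have "closedin X (topspace X - ?U)" "x \<in> topspace X - (topspace X - ?U)"
    using A W' y Some x by auto
  then obtain f where f: "continuous_map X (top_of_set {0..1::real}) f" "f x = 0"
      "f ` (topspace X - ?U) \<subseteq> {1}"
    using cr unfolding completely_regular_space_def by meson
  let ?h = "case_option 1 f"
  have "continuous_map Y euclideanreal ?h"
  proof (rule continuous_map_one_point_topology)
    show "continuous_map X euclideanreal (\<lambda>x. ?h (Some x))"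
      unfolding option.case using f(1) by (simp add: continuous_map_in_subtopology)
    show "?h (Some x) = ?h None" if "x \<in> topspace X - A" for x
      using f(3) that by auto
  qed (fact A)
  moreover have "?h ` (topspace Y - W) \<subseteq> {1}"
    using f(3) by (auto simp: topspace_one_point_topology)
  ultimately show ?thesis
    using Some f by (intro exI[of _ ?h]) simp
qed

lemma completely_regular_space_one_point_topology:
  assumes "completely_regular_space X"
  shows "completely_regular_space Y"
  unfolding completely_regular_space_alt
proof (intro allI impI)
  fix S y
  assume S: "closedin Y S" and y: "y \<in> topspace Y - S"
  then have "openin Y (topspace Y - S)"
    by blast
  then obtain h where "continuous_map Y euclideanreal h" "h y = 0"
      "h ` (topspace Y - (topspace Y - S)) \<subseteq> {1}"
    using completely_regular_separation[OF assms _ y] by blast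
  moreover have "topspace Y - (topspace Y - S) = S"
    using closedin_subset[OF S] by blast
  ultimately show "\<exists>f. continuous_map Y euclideanreal f \<and> f y = 0 \<and> f ` S \<subseteq> {1}"
    by metis
qed

text \<open>Only a neighbourhood of \<open>None\<close> missing a given point of \<open>X\<close>
  needs work; it is the nonzero set of a function vanishing at that point and equal to 1 at
  \<open>None\<close>.\<close>

lemma t1_space_one_point_topology:
  assumes cr: "completely_regular_space X" and t1: "t1_space X"
  shows "t1_space Y"
  unfolding t1_space_def
proof (intro ballI impI)
  fix y z
  assume y: "y \<in> topspace Y" and z: "z \<in> topspace Y" and yz: "y \<noteq> z"
  show "\<exists>U. openin Y U \<and> y \<in> U \<and> z \<notin> U"
  proof (cases y)
    case (Some x)
    then have x: "x \<in> topspace X"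
      using y by (auto simp: topspace_one_point_topology)
    \<comment> \<open>If \<open>z\<close> is \<open>None\<close>, nothing has to be removed, because
      the whole copy of \<open>X\<close> misses it.\<close>
    then have "openin X (topspace X - (case z of None \<Rightarrow> {} | Some z' \<Rightarrow> {z'} \<inter> topspace X))"
      using t1 by (auto split: option.split simp: t1_space_closedin_singleton Int_insert_left)
    then have "openin Y (Some ` (topspace X - (case z of None \<Rightarrow> {} | Some z' \<Rightarrow> {z'} \<inter> topspace X)))"
      by (simp add: openin_one_point_topology_Some)
    then show ?thesis
      using Some x yz by (intro exI conjI) (auto split: option.splits)
  next
    case None
    then obtain x where x: "z = Some x" "x \<in> topspace X"
      using z yz by (auto simp: topspace_one_point_topology)
    then have "openin Y (Some ` topspace X)"
      by (simp add: openin_one_point_topology_Some)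
    then obtain h where h: "continuous_map Y euclideanreal h" "h z = 0"
        "h ` (topspace Y - Some ` topspace X) \<subseteq> {1}"
      using completely_regular_separation[OF cr, of "Some ` topspace X" z] x by blast
    have "openin Y {y \<in> topspace Y. h y \<in> - {0}}"
      using h(1) by (rule openin_continuous_map_preimage) auto
    moreover have "h None = 1"
      using h(3) y None by auto
    ultimately show ?thesis
      using None y h(2) by (intro exI[of _ "{y \<in> topspace Y. h y \<in> - {0}}"]) auto
  qed
qed

lemma subtopology_one_point_topology_homeomorphic:
  "subtopology Y (topspace Y - {None}) homeomorphic_space X"
proof -
  have "topspace Y - {None} = Some ` topspace X"
    by (auto simp: topspace_one_point_topology)
  then show ?thesis
    using embedding_map_Some unfolding embedding_map_def
    by (metis homeomorphic_map_imp_homeomorphic_space homeomorphic_space_sym)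
qed

text \<open>Every neighbourhood of \<open>None\<close> contains all points of \<open>X\<close>
  outside some member of \<open>\<O>\<close>, because the witness is 1 and not 0 there.\<close>

lemma None_in_closure_of:
  assumes C: "C \<subseteq> topspace X" and "\<And>A. A \<in> \<O> \<Longrightarrow> \<not> C \<subseteq> A"
  shows "None \<in> Y closure_of (Some ` C)"
  unfolding in_closure_of
proof (intro conjI allI impI)
  fix W
  assume W: "None \<in> W \<and> openin Y W"
  then obtain A f where A: "A \<in> \<O>"
    "\<forall>x\<in>topspace X - A. f x = (1::real)" "\<forall>x\<in>topspace X. Some x \<notin> W \<longrightarrow> f x = 0"
    unfolding openin_one_point_topology by blast
  then obtain x where "x \<in> C" "x \<notin> A"
    using assms by blast
  then have "Some x \<in> W"
    using A C by force
  then show "\<exists>y. y \<in> Some ` C \<and> y \<in> W"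
    using \<open>x \<in> C\<close> by blast
qed (auto simp: topspace_one_point_topology)

text \<open>Each component joined with \<open>None\<close> lies between its copy and the closure of
  that copy, so it is connected. These sets all share \<open>None\<close> and their union is the
  extension.\<close>

lemma one_point_connectification_one_point_topology:
  assumes ne: "topspace X \<noteq> {}"
    and big: "\<And>A C. A \<in> \<O> \<Longrightarrow> C \<in> connected_components_of X \<Longrightarrow> \<not> C \<subseteq> A"
  shows "one_point_connectification X Y"
  unfolding one_point_connectification_def
proof (intro conjI)
  have sub: "C \<subseteq> topspace X" if "C \<in> connected_components_of X" for C
    using that by (rule connected_components_of_subset)
  have cl: "None \<in> Y closure_of (Some ` C)" if "C \<in> connected_components_of X" for C
    by (rule None_in_closure_of[OF sub[OF that] big[OF _ that]])
  let ?\<C> = "(\<lambda>C. insert None (Some ` C)) ` connected_components_of X"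
  have conn: "connectedin Y (insert None (Some ` C))" if C: "C \<in> connected_components_of X" for C
  proof (rule connectedin_intermediate_closure_of)
    show "connectedin Y (Some ` C)"
      using C connectedin_connected_components_of connectedin_continuous_map_image
        continuous_map_Some by blast
    show "insert None (Some ` C) \<subseteq> Y closure_of (Some ` C)"
      using cl[OF C] sub[OF C] closure_of_subset[of "Some ` C" Y]
      by (auto simp: topspace_one_point_topology)
  qed blast
  have comp: "\<Union>(connected_components_of X) = topspace X"
    by (rule Union_connected_components_of)
  then obtain C where C: "C \<in> connected_components_of X"
    using ne by blast
  have "connectedin Y (\<Union>?\<C>)"
    using conn C by (intro connectedin_Union) auto
  moreover have "\<Union>?\<C> = topspace Y"
    using C comp by (auto simp: topspace_one_point_topology)
  ultimately show "connected_space Y"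
    by (simp add: connectedin_topspace)
  show "embedding_map X Y Some"
    by (rule embedding_map_Some)
  have "None \<in> Y closure_of (Some ` topspace X)"
    using cl[OF C] sub[OF C] closure_of_mono[of "Some ` C" "Some ` topspace X" Y] by blast
  moreover have "Some ` topspace X \<subseteq> Y closure_of (Some ` topspace X)"
    by (intro closure_of_subset) (auto simp: topspace_one_point_topology)
  ultimately show "Y closure_of (Some ` topspace X) = topspace Y"
    using closure_of_subset_topspace[of Y] by (auto simp: topspace_one_point_topology)
  show "\<exists>p. topspace Y - Some ` topspace X = {p}"
    by (auto simp: topspace_one_point_topology)
qed

lemma pseudocompact_space_one_point_topology:
  assumes "pseudocompact_space X"
  shows "pseudocompact_space Y"
  unfolding pseudocompact_space_def
proof (intro allI impI)
  fix h
  assume "continuous_map Y euclideanreal h"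
  then have "continuous_map X euclideanreal (h \<circ> Some)"
    using continuous_map_Some continuous_map_compose by blast
  then have "bounded ((h \<circ> Some) ` topspace X)"
    using assms unfolding pseudocompact_space_def by blast
  then show "bounded (h ` topspace Y)"
    by (simp add: topspace_one_point_topology image_image)
qed

end

section \<open>Separation axioms of the extension\<close>

lemma T_space_imp_t1_space: "T_space i X \<Longrightarrow> t1_space X"
  by (cases i) auto

lemma T_space_imp_completely_regular_space:
  assumes "T_space i X"
  shows "completely_regular_space X"
proof -
  have "normal_space X" if "hereditarily_normal_space X"
    using that unfolding hereditarily_normal_space_def by (metis order_refl subtopology_topspace)
  then show ?thesis
    using assms
    by (cases i) (auto simp: normal_imp_completely_regular_space_gen perfectly_normal_space_def)
qed

lemma T_space_imp_Hausdorff_space: "T_space i X \<Longrightarrow> Hausdorff_space X"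
  by (meson T_space_imp_completely_regular_space T_space_imp_t1_space
      completely_regular_imp_regular_space regular_t1_eq_Hausdorff_space)

text \<open>The complement of \<open>None\<close> is homeomorphic to \<open>X\<close>, so the
  results on adding one point carry normality and hereditary normality over; the regularity they
  require comes from complete regularity.\<close>

lemma T_space_one_point_topology:
  assumes "directed_open_cover X \<O>" and i: "i \<noteq> T6" and "T_space i X"
  shows "T_space i (one_point_topology X \<O>)"
proof -
  interpret directed_open_cover X \<O> by fact
  have cr: "completely_regular_space X" and t1: "t1_space X"
    using assms(3) T_space_imp_completely_regular_space T_space_imp_t1_space by blast+
  have Y: "completely_regular_space Y" "t1_space Y"
    using cr t1 completely_regular_space_one_point_topology t1_space_one_point_topology by auto
  have reg: "regular_space Y"
    using Y completely_regular_imp_regular_space by blast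
  note hom = subtopology_one_point_topology_homeomorphic
  show ?thesis
  proof (cases i)
    case T4
    then have "normal_space X"
      using assms(3) by simp
    then have "normal_space (subtopology Y (topspace Y - {None}))"
      using homeomorphic_normal_space[OF hom] by simp
    moreover have "closedin Y {None}"
      using Y(2) by (simp add: t1_space_closedin_singleton topspace_one_point_topology)
    ultimately have "normal_space Y"
      by (metis normal_space_one_point[OF reg])
    then show ?thesis
      using T4 Y by simp
  next
    case T5
    then have "hereditarily normal_space X"
      using assms(3) by (simp add: hereditarily_normal_space_def hereditarily_def)
    then have "hereditarily normal_space (subtopology Y (topspace Y - {None}))"
      using homeomorphic_hereditarily_normal_space[OF hom] by simp
    then have "hereditarily_normal_space (subtopology Y (topspace Y - {None}))"
      by (simp only: hereditarily_normal_space_def hereditarily_def)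
    then have "hereditarily_normal_space Y"
      by (rule hereditarily_normal_space_one_point[OF reg Y(2)])
    then show ?thesis
      using T5 Y by simp
  qed (use Y i in auto)
qed

section \<open>Compact components and the choice of the ideal\<close>

text \<open>Local connectedness makes the component open, and compactness makes its image closed in
  the Hausdorff space \<open>Y\<close>. A nonempty clopen set missing \<open>p\<close> contradicts
  connectedness.\<close>

lemma not_compactin_component_of_one_point_connectification:
  assumes lc: "locally_connected_space X" and conn: "one_point_connectification X Y"
    and Haus: "Hausdorff_space Y" and C: "C \<in> connected_components_of X"
  shows "\<not> compactin X C"
proof
  assume comp: "compactin X C"
  obtain p where p: "topspace Y - Some ` topspace X = {p}"
    and Y: "connected_space Y" and emb: "embedding_map X Y Some"
    using conn unfolding one_point_connectification_def by blast
  have hom: "homeomorphic_map X (subtopology Y (Some ` topspace X)) Some"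
    using emb by (simp add: embedding_map_def)
  have cont: "continuous_map X Y Some"
    using homeomorphic_imp_continuous_map[OF hom] by (simp add: continuous_map_in_subtopology)
  then have sub: "Some ` topspace X \<subseteq> topspace Y"
    by (rule continuous_map_image_subset_topspace)
  \<comment> \<open>Closedness of \<open>{p}\<close> makes the copy of \<open>X\<close> open in
    \<open>Y\<close>, so sets open in \<open>X\<close> have open images.\<close>
  have "closedin Y {p}"
    using p Haus by (metis DiffD1 Hausdorff_imp_t1_space insertI1 t1_space_closedin_singleton)
  then have "openin Y (topspace Y - {p})"
    by blast
  moreover have "topspace Y - {p} = Some ` topspace X"
    using p sub by blast
  ultimately have open_X: "openin Y (Some ` topspace X)"
    by simp
  have "openin X C"
    using lc C by (rule openin_connected_components_of_locally_connected_space)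
  then have "openin (subtopology Y (Some ` topspace X)) (Some ` C)"
    using homeomorphic_imp_open_map[OF hom] by (simp add: open_map_def)
  then have "openin Y (Some ` C)"
    using open_X openin_trans_full by blast
  moreover have "closedin Y (Some ` C)"
    using image_compactin[OF comp cont] Haus by (rule compactin_imp_closedin[rotated])
  ultimately have "Some ` C = {} \<or> Some ` C = topspace Y"
    using Y unfolding connected_space_clopen_in by blast
  moreover have "C \<noteq> {}"
    using C nonempty_connected_components_of by blast
  moreover have "p \<in> topspace Y" "p \<notin> Some ` topspace X"
    using p by blast+
  ultimately show False
    using connected_components_of_subset[OF C] by blast
qed

text \<open>\<open>\<O>\<close> consists of the sets whose trace on every component is covered by finitely many members of a
  bad cover of that component, so the new point will be a limit of every component.\<close>

lemma ex_directed_open_cover: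
  assumes lc: "locally_connected_space X"
    and nc: "\<And>C. C \<in> connected_components_of X \<Longrightarrow> \<not> compactin X C"
  obtains \<O> where "directed_open_cover X \<O>"
    "\<And>A C. A \<in> \<O> \<Longrightarrow> C \<in> connected_components_of X \<Longrightarrow> \<not> C \<subseteq> A"
proof -
  let ?K = "connected_components_of X"
  have "\<exists>\<U>. (\<forall>U\<in>\<U>. openin X U) \<and> C \<subseteq> \<Union>\<U> \<and> (\<forall>\<F>. finite \<F> \<and> \<F> \<subseteq> \<U> \<longrightarrow> \<not> C \<subseteq> \<Union>\<F>)"
    if C: "C \<in> ?K" for C
  proof (rule ccontr)
    assume "\<not> ?thesis"
    then have "compactin X C"
      unfolding compactin_def using connected_components_of_subset[OF C] by meson
    then show False
      using nc[OF C] by blast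
  qed
  then obtain \<U> where \<U>: "\<And>C U. C \<in> ?K \<Longrightarrow> U \<in> \<U> C \<Longrightarrow> openin X U"
    "\<And>C. C \<in> ?K \<Longrightarrow> C \<subseteq> \<Union>(\<U> C)"
    "\<And>C \<F>. C \<in> ?K \<Longrightarrow> finite \<F> \<Longrightarrow> \<F> \<subseteq> \<U> C \<Longrightarrow> \<not> C \<subseteq> \<Union>\<F>"
    by metis
  define \<O> where "\<O> = {A. \<forall>C\<in>?K. \<exists>\<F>. finite \<F> \<and> \<F> \<subseteq> \<U> C \<and> A \<inter> C \<subseteq> \<Union>\<F>}"
  show thesis
  proof
    show "directed_open_cover X \<O>"
    proof
      show "\<O> \<noteq> {}"
        unfolding \<O>_def by (auto intro!: exI[of _ "{}"])
      show "A \<union> B \<in> \<O>" if A: "A \<in> \<O>" and B: "B \<in> \<O>" for A B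
        unfolding \<O>_def
      proof (intro CollectI ballI)
        fix C
        assume C: "C \<in> ?K"
        have *: "\<exists>\<F>. finite \<F> \<and> \<F> \<subseteq> \<U> C \<and> A \<inter> C \<subseteq> \<Union>\<F>" if "A \<in> \<O>" for A
          using that C unfolding \<O>_def by simp
        obtain F where F: "finite F" "F \<subseteq> \<U> C" "A \<inter> C \<subseteq> \<Union>F"
          using *[OF A] by (elim exE conjE)
        obtain G where G: "finite G" "G \<subseteq> \<U> C" "B \<inter> C \<subseteq> \<Union>G"
          using *[OF B] by (elim exE conjE)
        have "finite (F \<union> G)" "F \<union> G \<subseteq> \<U> C" "(A \<union> B) \<inter> C \<subseteq> \<Union>(F \<union> G)"
          using F G by auto
        then show "\<exists>\<F>. finite \<F> \<and> \<F> \<subseteq> \<U> C \<and> (A \<union> B) \<inter> C \<subseteq> \<Union>\<F>"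
          by meson
      qed
      fix x
      assume "x \<in> topspace X"
      then have "x \<in> \<Union>?K"
        by (simp add: Union_connected_components_of)
      then obtain C where C: "C \<in> ?K" "x \<in> C"
        by (elim UnionE)
      then have "x \<in> \<Union>(\<U> C)"
        using \<U>(2)[OF C(1)] by (rule_tac subsetD)
      then obtain U where U: "U \<in> \<U> C" "x \<in> U"
        by (elim UnionE)
      \<comment> \<open>Intersecting with the open component \<open>C\<close> empties the trace on
        every other component, while \<open>U\<close> alone covers the trace on
        \<open>C\<close>.\<close>
      show "\<exists>A\<in>\<O>. openin X A \<and> x \<in> A"
      proof (intro bexI conjI)
        show "openin X (U \<inter> C)"
          using \<U>(1)[OF C(1) U(1)] openin_connected_components_of_locally_connected_space[OF lc C(1)]
          by blast
        show "U \<inter> C \<in> \<O>"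
          unfolding \<O>_def
        proof (intro CollectI ballI)
          fix D
          assume D: "D \<in> ?K"
          show "\<exists>\<F>. finite \<F> \<and> \<F> \<subseteq> \<U> D \<and> U \<inter> C \<inter> D \<subseteq> \<Union>\<F>"
          proof (cases "D = C")
            case True
            then show ?thesis
              using U(1) by (intro exI[of _ "{U}"]) simp
          next
            case False
            then have "C \<inter> D = {}"
              using pairwise_disjoint_connected_components_of[of X] C D
              by (auto simp: pairwise_def disjnt_def)
            then show ?thesis
              by (intro exI[of _ "{}"]) (simp add: Int_assoc)
          qed
        qed
      qed (use U C in auto)
    qed
    fix A C
    assume A: "A \<in> \<O>" and C: "C \<in> ?K"
    then have "\<exists>\<F>. finite \<F> \<and> \<F> \<subseteq> \<U> C \<and> A \<inter> C \<subseteq> \<Union>\<F>"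
      unfolding \<O>_def by simp
    then obtain \<F> where F: "finite \<F>" "\<F> \<subseteq> \<U> C" "A \<inter> C \<subseteq> \<Union>\<F>"
      by (elim exE conjE)
    have "\<not> C \<subseteq> \<Union>\<F>"
      using \<U>(3)[OF C F(1,2)] .
    then show "\<not> C \<subseteq> A"
      using F(3) by (metis inf.absorb2)
  qed
qed

lemma ex_one_point_connectification:
  fixes X :: "'a topology"
  assumes i: "i \<noteq> T6" and ne: "topspace X \<noteq> {}"
    and lc: "locally_connected_space X" and pc: "pseudocompact_space X" and T: "T_space i X"
    and nc: "\<And>C. C \<in> connected_components_of X \<Longrightarrow> \<not> compactin X C"
  shows "\<exists>Y :: 'a option topology. one_point_connectification X Y \<and> pseudocompact_space Y \<and> T_space i Y"
proof -
  obtain \<O> where D: "directed_open_cover X \<O>"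
    and big: "\<And>A C. A \<in> \<O> \<Longrightarrow> C \<in> connected_components_of X \<Longrightarrow> \<not> C \<subseteq> A"
    using ex_directed_open_cover[OF lc nc] by metis
  show ?thesis
    using directed_open_cover.one_point_connectification_one_point_topology[OF D ne big]
      directed_open_cover.pseudocompact_space_one_point_topology[OF D pc]
      T_space_one_point_topology[OF D i T]
    by blast
qed

section \<open>Consequences of Martin's Axiom\<close>

unbundle cardinal_syntax

text \<open>In this form countability can be compared with \<open>cardSuc natLeq\<close>, the first
  uncountable cardinal.\<close>

lemma countable_iff_ordLeq_natLeq: "countable A \<longleftrightarrow> |A| \<le>o natLeq"
proof -
  have "countable A \<longleftrightarrow> |A| \<le>o |UNIV :: nat set|"
    unfolding countable_def card_of_ordLeq[symmetric] by simp
  then show ?thesis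
    by (meson card_of_nat ordLeq_ordIso_trans ordIso_symmetric)
qed

lemma lepoll_iff_ordLeq: "A \<lesssim> B \<longleftrightarrow> |A| \<le>o |B|"
  by (simp add: lepoll_def card_of_ordLeq)

lemma lesspoll_iff_ordLess: "A \<prec> B \<longleftrightarrow> |A| <o |B|"
  using lepoll_iff_ordLeq[of B A] lepoll_antisym[of A B]
  by (auto simp: lesspoll_def lepoll_iff_ordLeq eqpoll_iff_card_of_ordIso ordLess_or_ordLeq
      intro: ordLeq_iff_ordLess_or_ordIso[THEN iffD1, THEN disjE] ordLess_imp_ordLeq
      dest: not_ordLess_ordIso)

text \<open>Transfinite recursion along \<open>\<omega>\<^sub>1\<close>, realised as the cardinal successor of \<open>natLeq\<close>.\<close>

lemma ex_omega1_sequence: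
  fixes A :: "'c set" and B :: "'b set" and Q :: "'b set \<Rightarrow> 'b \<Rightarrow> bool"
  assumes A: "uncountable A"
    and step: "\<And>S. S \<subseteq> B \<Longrightarrow> countable S \<Longrightarrow> \<exists>x\<in>B - S. Q S x"
  shows "\<exists>L lt. L \<subseteq> B \<and> uncountable L \<and> L \<lesssim> A \<and>
    (\<forall>x\<in>L. \<forall>y\<in>L. x \<noteq> y \<longrightarrow> lt x y \<or> lt y x) \<and>
    (\<forall>x\<in>L. countable {y\<in>L. lt y x} \<and> Q {y\<in>L. lt y x} x)"
proof -
  let ?r = "cardSuc natLeq"
  let ?I = "Field ?r"
  have card: "Card_order ?r"
    by (rule cardSuc_Card_order[OF natLeq_Card_order])
  then have wo: "Well_order ?r"
    by (rule card_order_on_well_order_on)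
  have I: "|?I| =o ?r"
    by (rule card_of_Field_ordIso[OF card])
  have unc: "uncountable ?I"
  proof
    assume "countable ?I"
    then have "?r \<le>o natLeq"
      unfolding countable_iff_ordLeq_natLeq using I ordIso_ordLeq_trans ordIso_symmetric by blast
    then show False
      using cardSuc_greater[OF natLeq_Card_order] not_ordLess_ordLeq by blast
  qed
  have "natLeq <o |A|"
    using A unfolding countable_iff_ordLeq_natLeq
    using card_of_Well_order natLeq_Well_order not_ordLeq_iff_ordLess by blast
  \<comment> \<open>The successor is the least cardinal above \<open>natLeq\<close>, so
    \<open>\<omega>\<^sub>1\<close> embeds into every uncountable set.\<close>
  then have "?r \<le>o |A|"
    by (rule cardSuc_least[OF natLeq_Card_order card_of_Card_order])
  then have le: "?I \<lesssim> A"
    unfolding lepoll_iff_ordLeq using I ordIso_ordLeq_trans by blast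
  \<comment> \<open>For \<open>a\<close> outside the field the segment is empty, so the recursion
    can be stated without restricting \<open>a\<close> to \<open>?I\<close>.\<close>
  have under: "countable (underS ?r a)" for a
  proof (cases "a \<in> ?I")
    case True
    then have "|underS ?r a| <o ?r"
      by (rule card_of_underS[OF card])
    then show ?thesis
      unfolding countable_iff_ordLeq_natLeq
      using cardSuc_ordLeq_ordLess[OF natLeq_Card_order card_of_Card_order] by blast
  qed (simp add: underS_empty)
  define R where "R = ?r - Id"
  have wf: "wf R"
    using wo unfolding R_def well_order_on_def by blast
  have uR: "underS ?r a = {b. (b, a) \<in> R}" for a
    by (auto simp: underS_def R_def)
  \<comment> \<open>The recursion sees earlier values only as a set \<open>S\<close>; for countable
    \<open>S \<subseteq> B\<close> the assumption \<open>step\<close> makes this choice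
    succeed.\<close>
  define c where "c S = (SOME x. x \<in> B - S \<and> Q S x)" for S
  define z where "z = wfrec R (\<lambda>f a. c (f ` underS ?r a))"
  have z: "z a = c (z ` underS ?r a)" for a
  proof -
    have "z a = c (cut z R a ` underS ?r a)"
      unfolding z_def by (subst wfrec[OF wf]) simp
    also have "cut z R a ` underS ?r a = z ` underS ?r a"
      by (rule image_cong) (auto simp: uR cut_apply)
    finally show ?thesis .
  qed
  have zB: "z a \<in> B - z ` underS ?r a \<and> Q (z ` underS ?r a) (z a)" for a
    using wf
  proof (induction a rule: wf_induct_rule)
    case (less a)
    then have "z ` underS ?r a \<subseteq> B"
      by (auto simp: uR)
    then have "\<exists>x\<in>B - z ` underS ?r a. Q (z ` underS ?r a) x"
      by (rule step[OF _ countable_image[OF under]])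
    then have "\<exists>x. x \<in> B - z ` underS ?r a \<and> Q (z ` underS ?r a) x"
      unfolding Bex_def .
    from someI_ex[OF this] show ?case
      by (simp only: c_def[symmetric] z[symmetric])
  qed
  have tot: "a \<in> underS ?r b \<or> b \<in> underS ?r a" if "a \<in> ?I" "b \<in> ?I" "a \<noteq> b" for a b
  proof -
    have "Total ?r"
      using wo by (simp add: order_on_defs)
    then show ?thesis
      using that by (auto simp: underS_def total_on_def)
  qed
  have inj: "inj_on z ?I"
  proof (rule inj_onI, rule ccontr)
    fix a b
    assume "a \<in> ?I" "b \<in> ?I" "z a = z b" "a \<noteq> b"
    then show False
      using tot[of a b] zB[of a] zB[of b] by (metis DiffD2 imageI)
  qed
  \<comment> \<open>The well-order is transported from indices to values; injectivity of
    \<open>z\<close> lets an index be recovered from its value.\<close>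
  define lt where "lt x y \<longleftrightarrow> (\<exists>a b. a \<in> underS ?r b \<and> b \<in> ?I \<and> x = z a \<and> y = z b)" for x y
  have lt: "{y \<in> z ` ?I. lt y (z b)} = z ` underS ?r b" if b: "b \<in> ?I" for b
  proof (intro set_eqI iffI)
    fix y
    assume "y \<in> {y \<in> z ` ?I. lt y (z b)}"
    then obtain a b' where "a \<in> underS ?r b'" "b' \<in> ?I" "y = z a" "z b = z b'"
      unfolding lt_def by blast
    moreover from this have "b = b'"
      using inj_onD[OF inj _ b] by blast
    ultimately show "y \<in> z ` underS ?r b"
      by blast
  next
    fix y
    assume "y \<in> z ` underS ?r b"
    then obtain a where a: "a \<in> underS ?r b" "y = z a"
      by blast
    then have "a \<in> ?I"
      using underS_Field by (metis in_mono)
    then show "y \<in> {y \<in> z ` ?I. lt y (z b)}"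
      using a b unfolding lt_def by blast
  qed
  show ?thesis
  proof (intro exI conjI ballI impI)
    show "z ` ?I \<subseteq> B"
      using zB by blast
    show "uncountable (z ` ?I)"
      using unc inj countable_image_inj_on by blast
    show "z ` ?I \<lesssim> A"
      using le image_lepoll lepoll_trans by blast
    show "lt x y \<or> lt y x" if "x \<in> z ` ?I" "y \<in> z ` ?I" "x \<noteq> y" for x y
      using that tot unfolding lt_def by blast
    show "countable {y \<in> z ` ?I. lt y x}" if "x \<in> z ` ?I" for x
      using that lt under by auto
    show "Q {y \<in> z ` ?I. lt y x} x" if "x \<in> z ` ?I" for x
      using that lt zB by auto
  qed
qed

section \<open>Transfer of Martin's Axiom and pseudo-intersections\<close>

text \<open>\<open>martins_axiom\<close> speaks of orders on sets of reals. An injection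
  \<open>e\<close> moves an order of size at most the continuum there, and its inverse
  \<open>d\<close> brings the filter back as a directed set.\<close>

lemma martins_axiom_generic:
  fixes P :: "'p set"
  assumes MA: martins_axiom and P: "P \<lesssim> (UNIV :: real set)" "P \<noteq> {}"
    and refl: "\<And>p. p \<in> P \<Longrightarrow> le p p"
    and antisym: "\<And>p q. p \<in> P \<Longrightarrow> q \<in> P \<Longrightarrow> le p q \<Longrightarrow> le q p \<Longrightarrow> p = q"
    and trans: "\<And>p q r. p \<in> P \<Longrightarrow> q \<in> P \<Longrightarrow> r \<in> P \<Longrightarrow> le p q \<Longrightarrow> le q r \<Longrightarrow> le p r"
    and ccc: "\<And>A. A \<subseteq> P \<Longrightarrow> (\<And>p q. p \<in> A \<Longrightarrow> q \<in> A \<Longrightarrow> p \<noteq> q \<Longrightarrow> \<not> (\<exists>r\<in>P. le r p \<and> le r q))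
      \<Longrightarrow> countable A"
    and dense: "\<And>D. D \<in> \<D> \<Longrightarrow> D \<subseteq> P \<and> (\<forall>p\<in>P. \<exists>d\<in>D. le d p)"
    and small: "\<D> \<prec> (UNIV :: real set)"
  shows "\<exists>G\<subseteq>P. (\<forall>p\<in>G. \<forall>q\<in>G. \<exists>r\<in>G. le r p \<and> le r q) \<and> (\<forall>D\<in>\<D>. G \<inter> D \<noteq> {})"
proof -
  obtain e :: "'p \<Rightarrow> real" where e: "inj_on e P"
    using P(1) unfolding lepoll_def by blast
  define d where "d = the_inv_into P e"
  have d: "d (e p) = p" if "p \<in> P" for p
    using that e by (simp add: d_def the_inv_into_f_f)
  define le' where "le' x y = le (d x) (d y)" for x y
  have po: "partial_order_on_set (e ` P) le'"
    unfolding partial_order_on_set_def le'_def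
  proof (intro conjI ballI impI)
    have dP: "d x \<in> P" "e (d x) = x" if "x \<in> e ` P" for x
      using that d by auto
    fix x y z
    assume x: "x \<in> e ` P" and y: "y \<in> e ` P"
    show "le (d x) (d x)"
      using refl dP(1)[OF x] .
    show "x = y" if "le (d x) (d y) \<and> le (d y) (d x)"
    proof -
      have "d x = d y"
        using that by (elim conjE) (rule antisym[OF dP(1)[OF x] dP(1)[OF y]])
      then show ?thesis
        using dP(2)[OF x] dP(2)[OF y] by metis
    qed
    show "le (d x) (d z)" if "z \<in> e ` P" "le (d x) (d y) \<and> le (d y) (d z)"
      using that(2) by (elim conjE) (rule trans[OF dP(1)[OF x] dP(1)[OF y] dP(1)[OF that(1)]])
  qed
  have c: "ma_ccc (e ` P) le'"
    unfolding ma_ccc_def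
  proof (intro allI impI, elim conjE)
    fix A
    assume A: "A \<subseteq> e ` P"
      and anti: "\<forall>p\<in>A. \<forall>q\<in>A. p \<noteq> q \<longrightarrow> \<not> ma_compatible (e ` P) le' p q"
    obtain B where B: "B \<subseteq> P" "A = e ` B"
      using A subset_imageE by metis
    have "countable B"
    proof (rule ccc[OF B(1)])
      fix p q
      assume pq: "p \<in> B" "q \<in> B" "p \<noteq> q"
      then have "e p \<noteq> e q"
        using inj_onD[OF e] B(1) by blast
      then have "\<not> ma_compatible (e ` P) le' (e p) (e q)"
        using anti B(2) pq by blast
      then show "\<not> (\<exists>r\<in>P. le r p \<and> le r q)"
        using pq B(1) unfolding ma_compatible_def le'_def by (auto simp: d subset_iff)
    qed
    then show "countable A"
      using B(2) by simp
  qed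
  have dn: "\<forall>D\<in>(`) e ` \<D>. ma_dense (e ` P) le' D"
  proof
    fix D'
    assume "D' \<in> (`) e ` \<D>"
    then obtain D where D: "D \<in> \<D>" "D' = e ` D"
      by blast
    then have *: "D \<subseteq> P" "\<And>p. p \<in> P \<Longrightarrow> \<exists>d\<in>D. le d p"
      using dense by auto
    show "ma_dense (e ` P) le' D'"
      unfolding ma_dense_def le'_def D(2)
    proof (intro conjI ballI)
      fix x
      assume "x \<in> e ` P"
      then obtain p where "p \<in> P" "x = e p"
        by blast
      then show "\<exists>y\<in>e ` D. le (d y) (d x)"
        using *(2)[of p] *(1) d by (metis image_eqI subset_eq)
    qed (use * in blast)
  qed
  have sm: "(`) e ` \<D> \<prec> (UNIV :: real set)"
    using image_lepoll small by (rule lesspoll_trans1)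
  obtain G where G: "ma_filter (e ` P) le' G" "\<And>D. D \<in> (`) e ` \<D> \<Longrightarrow> G \<inter> D \<noteq> {}"
    using MA P(2) po c dn sm unfolding martins_axiom_def by (metis image_is_empty)
  have GP: "G \<subseteq> e ` P" and Gd: "\<And>x y. x \<in> G \<Longrightarrow> y \<in> G \<Longrightarrow> \<exists>r\<in>G. le' r x \<and> le' r y"
    using G(1) unfolding ma_filter_def by blast+
  show ?thesis
  proof (intro exI conjI ballI)
    show "d ` G \<subseteq> P"
      using GP d by auto
    show "\<exists>r\<in>d ` G. le r p \<and> le r q" if "p \<in> d ` G" "q \<in> d ` G" for p q
      using that Gd unfolding le'_def by blast
    fix D
    assume D: "D \<in> \<D>"
    then obtain p where "p \<in> D" "e p \<in> G"
      using G(2)[of "e ` D"] by blast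
    then show "d ` G \<inter> D \<noteq> {}"
      using dense[OF D] d by (metis disjoint_iff imageI subset_iff)
  qed
qed

text \<open>In the code of a list, the pairs \<open>(i, 0)\<close> record its length and the pairs
  \<open>(i, Suc k)\<close> record that \<open>k\<close> lies in entry \<open>i\<close>. It serves
  to bound the number of forcing conditions.\<close>

lemma lists_nat_set_lepoll: "(UNIV :: nat set list set) \<lesssim> (UNIV :: nat set set)"
proof -
  define e :: "nat set list \<Rightarrow> nat set" where
    "e xs = prod_encode ` {(i, k). i < length xs \<and> (k = 0 \<or> k - 1 \<in> xs ! i)}" for xs
  have e: "prod_encode (i, k) \<in> e xs \<longleftrightarrow> i < length xs \<and> (k = 0 \<or> k - 1 \<in> xs ! i)" for i k xs
    unfolding e_def by (auto simp: inj_image_mem_iff[OF inj_prod_encode])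
  have "inj e"
  proof (rule injI)
    fix xs ys
    assume eq: "e xs = e ys"
    have "i < length xs \<longleftrightarrow> i < length ys" for i
      using e[of i 0 xs] e[of i 0 ys] eq by simp
    then have len: "length xs = length ys"
      by (metis linorder_neqE_nat nat_less_le)
    show "xs = ys"
    proof (rule nth_equalityI[OF len])
      fix i
      assume "i < length xs"
      then have "k \<in> xs ! i \<longleftrightarrow> k \<in> ys ! i" for k
        using e[of i "Suc k" xs] e[of i "Suc k" ys] eq len by simp
      then show "xs ! i = ys ! i"
        by blast
    qed
  qed
  then show ?thesis
    unfolding lepoll_def by blast
qed

text \<open>Solovay's forcing with finite conditions: \<open>(s, T)\<close> promises that the pseudo-intersection
  contains \<open>s\<close> and that every later element lies in \<open>\<Inter>T\<close>. Conditions with the same first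
  component are compatible, so the order is ccc.\<close>

lemma martins_axiom_pseudo_intersection:
  fixes \<N> :: "nat set set"
  assumes MA: martins_axiom and small: "\<N> \<prec> (UNIV :: real set)"
    and inf: "\<And>T. finite T \<Longrightarrow> T \<subseteq> \<N> \<Longrightarrow> infinite (\<Inter>T)"
  obtains S where "infinite S" "\<And>N. N \<in> \<N> \<Longrightarrow> finite (S - N)"
proof -
  define P where "P = {(s :: nat set, T). finite s \<and> finite T \<and> T \<subseteq> \<N>}"
  define le where "le = (\<lambda>(s', T') (s, T). s \<subseteq> s' \<and> T \<subseteq> T' \<and> s' - s \<subseteq> (\<Inter>T :: nat set))"
  \<comment> \<open>Meeting \<open>meets N\<close> puts \<open>N\<close> among the promises, which
    makes \<open>S - N\<close> finite; meeting every \<open>large m\<close> makes \<open>S\<close>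
    infinite.\<close>
  define meets where "meets N = {(s, T) \<in> P. N \<in> T}" for N
  define large where "large m = {(s, T) \<in> P. m \<le> card s}" for m
  let ?\<D> = "meets ` \<N> \<union> range large"
  have "P \<lesssim> (UNIV :: nat set list set)"
  proof -
    have "\<exists>l. \<forall>T :: nat set set. finite T \<longrightarrow> set (l T) = T"
      using finite_list by metis
    then obtain l where l: "\<And>T :: nat set set. finite T \<Longrightarrow> set (l T) = T"
      by blast
    \<comment> \<open>A condition is coded by \<open>s\<close> followed by an enumeration of the
      finite set \<open>T\<close>.\<close>
    have "inj_on (\<lambda>(s, T). s # l T) P"
      using l by (auto simp: inj_on_def P_def) (metis)+
    then show ?thesis
      unfolding lepoll_def by blast
  qed
  then have P: "P \<lesssim> (UNIV :: real set)"
    using lists_nat_set_lepoll nat_sets_eqpoll_reals lepoll_trans lepoll_trans2 by blast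
  have ne: "P \<noteq> {}"
    by (auto simp: P_def)
  have ccc: "countable A" if "A \<subseteq> P"
    and anti: "\<And>p q. p \<in> A \<Longrightarrow> q \<in> A \<Longrightarrow> p \<noteq> q \<Longrightarrow> \<not> (\<exists>r\<in>P. le r p \<and> le r q)" for A
  proof -
    have "inj_on fst A"
    proof (rule inj_onI, rule ccontr)
      fix p q
      assume pq: "p \<in> A" "q \<in> A" "fst p = fst q" "p \<noteq> q"
      obtain s T T' where [simp]: "p = (s, T)" "q = (s, T')"
        using pq(3) by (cases p; cases q) auto
      have "(s, T \<union> T') \<in> P"
        using pq(1,2) \<open>A \<subseteq> P\<close> by (auto simp: P_def)
      moreover have "le (s, T \<union> T') p" "le (s, T \<union> T') q"
        by (auto simp: le_def)
      ultimately show False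
        using anti[OF pq(1,2,4)] by blast
    qed
    moreover have "fst ` A \<subseteq> Collect finite"
      using \<open>A \<subseteq> P\<close> by (auto simp: P_def)
    then have "countable (fst ` A)"
      using countable_Collect_finite countable_subset by blast
    ultimately show ?thesis
      using countable_image_inj_on by blast
  qed
  have dense: "D \<subseteq> P \<and> (\<forall>p\<in>P. \<exists>d\<in>D. le d p)" if "D \<in> ?\<D>" for D
  proof
    show "D \<subseteq> P"
      using that by (auto simp: meets_def large_def)
    show "\<forall>p\<in>P. \<exists>d\<in>D. le d p"
    proof
      fix p
      assume "p \<in> P"
      then obtain s T where p: "p = (s, T)" "finite s" "finite T" "T \<subseteq> \<N>"
        by (auto simp: P_def)
      consider N where "N \<in> \<N>" "D = meets N" | m where "D = large m"
        using \<open>D \<in> ?\<D>\<close> by blast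
      then show "\<exists>d\<in>D. le d p"
      proof cases
        case 1
        then show ?thesis
          using p by (intro bexI[of _ "(s, insert N T)"]) (auto simp: meets_def P_def le_def)
      next
        case (2 m)
        \<comment> \<open>Drawing \<open>F\<close> from \<open>\<Inter>T\<close> keeps the promise
          of \<open>p\<close>; overlap with \<open>s\<close> is harmless, since
          \<open>s \<union> F\<close> still has at least \<open>m\<close> elements.\<close>
        obtain F where F: "finite F" "card F = m" "F \<subseteq> \<Inter>T"
          using infinite_arbitrarily_large[OF inf[OF p(3,4)]] by blast
        then have "m \<le> card (s \<union> F)"
          using p(2) card_mono[of "s \<union> F" F] by simp
        then show ?thesis
          using p F 2 by (intro bexI[of _ "(s \<union> F, T)"]) (auto simp: large_def P_def le_def)
      qed
    qed
  qed
  have "|meets ` \<N>| <o |UNIV :: real set|"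
    using lesspoll_trans1[OF image_lepoll small] lesspoll_iff_ordLess by blast
  moreover have "|range large| <o |UNIV :: real set|"
  proof -
    have "\<not> |UNIV :: real set| \<le>o |range large|"
      using countable_lepoll[of "range large" "UNIV :: real set"] uncountable_UNIV_real
      by (auto simp: lepoll_iff_ordLeq)
    then show ?thesis
      by (simp only: not_ordLeq_iff_ordLess[OF card_of_Well_order card_of_Well_order])
  qed
  ultimately have "|?\<D>| <o |UNIV :: real set|"
    by (intro card_of_Un_ordLess_infinite) (auto simp: infinite_UNIV_char_0)
  then have small': "?\<D> \<prec> (UNIV :: real set)"
    by (simp add: lesspoll_iff_ordLess)
  have refl: "le p p" for p
    by (auto simp: le_def split: prod.split)
  have antisym: "p = q" if "le p q" "le q p" for p q
    using that by (auto simp: le_def split: prod.splits)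
  have trans: "le p r" if "le p q" "le q r" for p q r
    using that by (cases p; cases q; cases r) (simp add: le_def, blast)
  have "\<exists>G\<subseteq>P. (\<forall>p\<in>G. \<forall>q\<in>G. \<exists>r\<in>G. le r p \<and> le r q) \<and> (\<forall>D\<in>?\<D>. G \<inter> D \<noteq> {})"
    by (rule martins_axiom_generic[OF MA P ne refl antisym trans ccc dense small'])
  then obtain G where GP: "G \<subseteq> P" and Gd: "\<forall>p\<in>G. \<forall>q\<in>G. \<exists>r\<in>G. le r p \<and> le r q"
    and GD: "\<forall>D\<in>?\<D>. G \<inter> D \<noteq> {}"
    by (elim exE conjE)
  let ?S = "\<Union>(fst ` G)"
  show thesis
  proof
    show "infinite ?S"
    proof
      assume fin: "finite ?S"
      obtain s T where sT: "(s, T) \<in> G" "(s, T) \<in> large (Suc (card ?S))"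
        using bspec[OF GD, of "large (Suc (card ?S))"] by auto
      then have "s \<subseteq> ?S"
        by force
      then have "card s \<le> card ?S"
        using fin card_mono by blast
      then show False
        using sT(2) by (auto simp: large_def)
    qed
    fix N
    assume N: "N \<in> \<N>"
    then obtain s T where sT: "(s, T) \<in> G" "N \<in> T"
      using bspec[OF GD, of "meets N"] by (auto simp: meets_def)
    \<comment> \<open>An element \<open>k\<close> occurs in some condition of \<open>G\<close>. A
      common extension with \<open>(s, T)\<close> contains \<open>k\<close> and adds to
      \<open>s\<close> only elements of \<open>N\<close>.\<close>
    have "?S - N \<subseteq> s"
    proof
      fix k
      assume k: "k \<in> ?S - N"
      then obtain p where p: "p \<in> G" "k \<in> fst p"
        by blast
      then obtain s'' T'' where "le (s'', T'') (s, T)" "le (s'', T'') p"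
        using bspec[OF bspec[OF Gd sT(1)] p(1)] by auto
      then have "fst p \<subseteq> s''" "s'' - s \<subseteq> N"
        using sT(2) by (auto simp: le_def split: prod.splits)
      then show "k \<in> s"
        using k p by blast
    qed
    moreover have "finite s"
      using sT GP by (auto simp: P_def)
    ultimately show "finite (?S - N)"
      using finite_subset by blast
  qed
qed

unbundle no cardinal_syntax

section \<open>Weiss's theorem\<close>

text \<open>For T1 spaces this is countable compactness, expressed by accumulation points.\<close>

definition limit_point_compact_space :: "'a topology \<Rightarrow> bool" where
  "limit_point_compact_space X \<longleftrightarrow>
     (\<forall>S. S \<subseteq> topspace X \<and> infinite S \<longrightarrow> X derived_set_of S \<noteq> {})"

text \<open>An infinite set without limit points contains a closed discrete copy of the naturals.
  Tietze's theorem extends the numbering of that copy to an unbounded continuous function.\<close>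

lemma pseudocompact_normal_imp_limit_point_compact:
  assumes pc: "pseudocompact_space X" and norm: "normal_space X"
  shows "limit_point_compact_space X"
  unfolding limit_point_compact_space_def
proof (intro allI impI notI, elim conjE)
  fix S
  assume S: "S \<subseteq> topspace X" "infinite S" and der: "X derived_set_of S = {}"
  obtain e :: "nat \<Rightarrow> 'a" where e: "inj e" "range e \<subseteq> S"
    using S(2) infinite_countable_subset by blast
  let ?D = "range e"
  have D: "?D \<subseteq> topspace X" "X derived_set_of ?D = {}"
    using e S der derived_set_of_mono[of ?D S X] by auto
  then have cl: "closedin X ?D"
    by (simp add: closedin_contains_derived_set)
  have disc: "subtopology X ?D = discrete_topology ?D"
    using D by (simp add: subtopology_eq_discrete_topology)
  have "continuous_map (subtopology X ?D) euclideanreal (\<lambda>x. real (inv e x))"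
    unfolding disc by simp
  then obtain g where g: "continuous_map X euclideanreal g" "\<And>x. x \<in> ?D \<Longrightarrow> g x = real (inv e x)"
    using norm cl unfolding normal_space_iff_Tietze by metis
  then have "bounded (g ` topspace X)"
    using pc unfolding pseudocompact_space_def by blast
  moreover have "range real \<subseteq> g ` topspace X"
  proof clarify
    fix n
    have "g (e n) = real n"
      using g(2)[of "e n"] inv_f_f[OF e(1)] by simp
    then show "real n \<in> g ` topspace X"
      using D(1) by (metis image_eqI rangeI subsetD)
  qed
  ultimately obtain b where b: "\<And>n. norm (real n) \<le> b"
    unfolding bounded_iff by (metis rangeI subsetD)
  obtain n where "b < real n"
    using reals_Archimedean2 by blast
  then show False
    using b[of n] by simp
qed

text \<open>In a T1 space every neighbourhood of a limit point of \<open>S\<close> meets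
  \<open>S\<close> infinitely often, and a closed set keeps its limit points.\<close>

lemma limit_point_compact_closed:
  assumes lpc: "limit_point_compact_space X" and t1: "t1_space X"
    and C: "closedin X C" and S: "S \<subseteq> C" "infinite S"
  obtains z where "z \<in> C" "\<And>U. openin X U \<Longrightarrow> z \<in> U \<Longrightarrow> infinite (S \<inter> U)"
proof -
  have "S \<subseteq> topspace X"
    using S C closedin_subset by blast
  then have "X derived_set_of S \<noteq> {}"
    using lpc S(2) unfolding limit_point_compact_space_def by simp
  then obtain z where z: "z \<in> X derived_set_of S"
    by blast
  have "X derived_set_of S \<subseteq> X derived_set_of C"
    by (rule derived_set_of_mono[OF S(1)])
  also have "\<dots> \<subseteq> C"
    using C by (simp add: closedin_contains_derived_set)
  finally have "X derived_set_of S \<subseteq> C" .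
  moreover have "infinite (S \<inter> U)" if "openin X U" "z \<in> U" for U
  proof -
    have "z \<in> {x \<in> topspace X. \<forall>U. x \<in> U \<and> openin X U \<longrightarrow> infinite (S \<inter> U)}"
      using z t1[unfolded t1_space_derived_set_of_infinite_openin] by metis
    then show ?thesis
      using that by blast
  qed
  ultimately show thesis
    using z that by blast
qed

text \<open>Without a finite subcover, choose \<open>x n\<close> outside the first
  \<open>Suc n\<close> members of the cover. Each member then contains only finitely many terms,
  which rules out an accumulation point.\<close>

lemma limit_point_compact_countable_cover:
  assumes lpc: "limit_point_compact_space X" and t1: "t1_space X"
    and C: "closedin X C" and \<U>: "countable \<U>" "\<And>U. U \<in> \<U> \<Longrightarrow> openin X U" "C \<subseteq> \<Union>\<U>"
  obtains \<F> where "finite \<F>" "\<F> \<subseteq> \<U>" "C \<subseteq> \<Union>\<F>"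
proof (rule ccontr)
  assume "\<not> thesis"
  then have no: "\<not> C \<subseteq> \<Union>\<F>" if "finite \<F>" "\<F> \<subseteq> \<U>" for \<F>
    using that \<open>\<And>\<F>. finite \<F> \<Longrightarrow> \<F> \<subseteq> \<U> \<Longrightarrow> C \<subseteq> \<Union>\<F> \<Longrightarrow> thesis\<close> by blast
  have "\<U> \<noteq> {}"
    using no[of "{}"] \<U>(3) by auto
  define V where "V = from_nat_into \<U>"
  have V: "range V = \<U>"
    unfolding V_def using \<U>(1) \<open>\<U> \<noteq> {}\<close> by (simp add: range_from_nat_into)
  have "\<exists>x. x \<in> C - \<Union>(V ` {..n})" for n
    using no[of "V ` {..n}"] V by blast
  then obtain x where x: "\<And>n. x n \<in> C - \<Union>(V ` {..n})"
    by metis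
  have fin: "finite {n. x n \<in> V k}" for k
  proof (rule finite_subset)
    show "{n. x n \<in> V k} \<subseteq> {..<k}"
      using x by (auto simp: not_le[symmetric])
  qed simp
  \<comment> \<open>A value repeated infinitely often would lie in some \<open>V k\<close> for
    infinitely many indices.\<close>
  have inf: "infinite (range x)"
  proof
    assume "finite (range x)"
    then obtain n where n: "infinite {m. x m = x n}"
      using pigeonhole_infinite[of UNIV x] by auto
    obtain k where "x n \<in> V k"
      using x[of n] \<U>(3) V by blast
    then have "{m. x m = x n} \<subseteq> {m. x m \<in> V k}"
      by auto
    then show False
      using n fin finite_subset by blast
  qed
  have "range x \<subseteq> C"
    using x by blast
  then obtain z where z: "z \<in> C" "\<And>U. openin X U \<Longrightarrow> z \<in> U \<Longrightarrow> infinite (range x \<inter> U)"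
    using limit_point_compact_closed[OF lpc t1 C _ inf] by blast
  obtain k where k: "z \<in> V k"
    using z(1) \<U>(3) V by blast
  moreover have "openin X (V k)"
    using V \<U>(2) by blast
  ultimately have "infinite (range x \<inter> V k)"
    using z(2) by blast
  moreover have "range x \<inter> V k = x ` {n. x n \<in> V k}"
    by auto
  ultimately show False
    using fin by simp
qed

lemma perfectly_normal_open_Union_closed:
  assumes "perfectly_normal_space X" "openin X G"
  obtains C :: "nat \<Rightarrow> 'a set" where "\<And>n. closedin X (C n)" "G = (\<Union>n. C n)"
proof -
  have "gdelta_in X (topspace X - G)"
    using assms unfolding perfectly_normal_space_def by blast
  then have "fsigma_in X G"
    using assms(2) by (simp add: fsigma_in_gdelta_in openin_subset)
  then show thesis
    using that unfolding fsigma_in_ascending by metis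
qed

text \<open>The union of the isolating open sets is an F-sigma, and each of its closed pieces meets \<open>L\<close> in a
  closed discrete, hence finite, set.\<close>

lemma countable_discrete_subset:
  assumes lpc: "limit_point_compact_space X" and t1: "t1_space X" and pn: "perfectly_normal_space X"
    and U: "\<And>x. x \<in> L \<Longrightarrow> openin X (U x)" "\<And>x. x \<in> L \<Longrightarrow> L \<inter> U x = {x}"
  shows "countable L"
proof -
  have "openin X (\<Union>(U ` L))"
    using U(1) by blast
  then obtain C :: "nat \<Rightarrow> _" where C: "\<And>n. closedin X (C n)" "\<Union>(U ` L) = (\<Union>n. C n)"
    using perfectly_normal_open_Union_closed[OF pn] by metis
  have "finite (L \<inter> C n)" for n
  proof (rule ccontr)
    assume "infinite (L \<inter> C n)"
    then obtain z where z: "z \<in> C n" "\<And>U. openin X U \<Longrightarrow> z \<in> U \<Longrightarrow> infinite (L \<inter> C n \<inter> U)"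
      using limit_point_compact_closed[OF lpc t1 C(1)[of n], of "L \<inter> C n"] by blast
    then obtain x where x: "x \<in> L" "z \<in> U x"
      using C(2) by blast
    have "finite (L \<inter> C n \<inter> U x)"
      by (rule finite_subset[of _ "{x}"]) (use U(2)[OF x(1)] in auto)
    then show False
      using z(2)[OF U(1)[OF x(1)] x(2)] by blast
  qed
  then have "countable (\<Union>n. L \<inter> C n)"
    by (intro countable_UN) (auto intro: countable_finite)
  moreover have "L \<subseteq> (\<Union>n. L \<inter> C n)"
    using U(2) C(2) by blast
  ultimately show ?thesis
    using countable_subset by blast
qed

section \<open>Covers of size below the continuum\<close>

text \<open>Sequences of length \<open>\<omega>\<^sub>1\<close> inject into such an
  \<open>A\<close>, so they have fewer than continuum many terms and Martin's Axiom can be applied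
  to families indexed by them.\<close>

lemma not_continuum_hypothesisE:
  assumes "\<not> continuum_hypothesis"
  obtains A :: "real set" where "uncountable A" "A \<prec> (UNIV :: real set)"
  using assms unfolding continuum_hypothesis_def
  by (metis lesspoll_def subset_UNIV subset_imp_lepoll)

text \<open>Otherwise \<open>D\<close> has an infinite subset almost disjoint from every \<open>closure (V y)\<close>; an accumulation
  point of it lies in no \<open>V y\<close>.\<close>

lemma martins_axiom_separable_cover:
  assumes MA: martins_axiom and lpc: "limit_point_compact_space X" and t1: "t1_space X"
    and L: "L \<prec> (UNIV :: real set)" and D: "countable D" "D \<subseteq> topspace X"
    and V: "\<And>y. y \<in> L \<Longrightarrow> openin X (V y)" and cover: "X closure_of D \<subseteq> \<Union>(V ` L)"
  obtains T where "finite T" "T \<subseteq> L" "X closure_of D \<subseteq> (\<Union>y\<in>T. X closure_of V y)"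
proof (rule ccontr)
  assume "\<not> thesis"
  then have no: "\<not> X closure_of D \<subseteq> (\<Union>y\<in>T. X closure_of V y)" if "finite T" "T \<subseteq> L" for T
    using that \<open>\<And>T. finite T \<Longrightarrow> T \<subseteq> L \<Longrightarrow> X closure_of D \<subseteq> (\<Union>y\<in>T. X closure_of V y) \<Longrightarrow> thesis\<close>
    by blast
  have V_cl: "V y \<subseteq> X closure_of V y" if "y \<in> L" for y
    by (rule closure_of_subset[OF openin_subset[OF V[OF that]]])
  have inf: "infinite (D - (\<Union>y\<in>T. X closure_of V y))" if T: "finite T" "T \<subseteq> L" for T
  proof
    let ?R = "D - (\<Union>y\<in>T. X closure_of V y)"
    assume fin: "finite ?R"
    have sub: "?R \<subseteq> X closure_of D"
      using closure_of_subset[OF D(2)] by blast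
    have "\<forall>x\<in>?R. \<exists>y\<in>L. x \<in> V y"
      using sub cover by blast
    then obtain c where c: "\<And>x. x \<in> ?R \<Longrightarrow> c x \<in> L \<and> x \<in> V (c x)"
      by metis
    \<comment> \<open>Finitely many leftover points need only finitely many further
      \<open>V y\<close>; the enlarged finite family then covers \<open>D\<close>, hence its
      closure.\<close>
    let ?T = "T \<union> c ` ?R"
    have T': "finite ?T" "?T \<subseteq> L"
      using T fin c by auto
    have "x \<in> (\<Union>y\<in>?T. X closure_of V y)" if "x \<in> D" for x
    proof (cases "x \<in> ?R")
      case True
      then have "x \<in> X closure_of V (c x)"
        using c[OF True] V_cl by blast
      then show ?thesis
        using True by blast
    qed (use that in blast)
    moreover have "closedin X (\<Union>y\<in>?T. X closure_of V y)"
      using T'(1) by (intro closedin_Union) auto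
    ultimately have "X closure_of D \<subseteq> (\<Union>y\<in>?T. X closure_of V y)"
      by (intro closure_of_minimal) blast+
    then show False
      using no[OF T'] by blast
  qed
  have infD: "infinite D"
    using inf[of "{}"] by simp
  define d where "d = from_nat_into D"
  have d: "bij_betw d UNIV D"
    unfolding d_def using D(1) infD by (rule bij_betw_from_nat_into)
  \<comment> \<open>\<open>D\<close> is identified with the naturals, and \<open>N y\<close>
    collects the indices of points outside the closure of \<open>V y\<close>. Finite intersections
    of these sets are infinite by \<open>inf\<close>.\<close>
  define N where "N y = {k. d k \<notin> X closure_of V y}" for y
  have small: "N ` L \<prec> (UNIV :: real set)"
    using image_lepoll L by (rule lesspoll_trans1)
  have "infinite (\<Inter>T)" if T: "finite T" "T \<subseteq> N ` L" for T
  proof -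
    obtain T' where T': "T' \<subseteq> L" "finite T'" "T = N ` T'"
      using finite_subset_image[OF T] by blast
    have "D - (\<Union>y\<in>T'. X closure_of V y) \<subseteq> d ` \<Inter>T"
      unfolding T'(3) N_def using bij_betw_imp_surj_on[OF d] by auto
    then show ?thesis
      using inf[OF T'(2,1)] finite_subset by blast
  qed
  then obtain S where S: "infinite S" "\<And>y. y \<in> L \<Longrightarrow> finite (S - N y)"
    using martins_axiom_pseudo_intersection[OF MA small] by (metis imageI)
  have "inj_on d S"
    using d by (meson bij_betw_imp_inj_on inj_on_subset subset_UNIV)
  then have "infinite (d ` S)"
    using S(1) finite_imageD by blast
  moreover have "d ` S \<subseteq> X closure_of D"
    using bij_betw_imp_surj_on[OF d] closure_of_subset[OF D(2)] by blast
  ultimately obtain z where z: "z \<in> X closure_of D"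
    "\<And>U. openin X U \<Longrightarrow> z \<in> U \<Longrightarrow> infinite (d ` S \<inter> U)"
    using limit_point_compact_closed[OF lpc t1 closedin_closure_of] by metis
  then obtain y where y: "y \<in> L" "z \<in> V y"
    using cover by blast
  \<comment> \<open>Points in \<open>V y\<close> have indices outside \<open>N y\<close>, and
    \<open>S\<close> has only finitely many of these.\<close>
  have "d ` S \<inter> V y \<subseteq> d ` (S - N y)"
    using V_cl[OF y(1)] unfolding N_def by blast
  then have "finite (d ` S \<inter> V y)"
    using S(2)[OF y(1)] finite_subset by blast
  then show False
    using z(2)[OF V[OF y(1)] y(2)] by blast
qed

theorem compact_space_if_martins_axiom:
  assumes MA: martins_axiom and CH: "\<not> continuum_hypothesis"
    and pn: "perfectly_normal_space X" and t1: "t1_space X" and lpc: "limit_point_compact_space X"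
  shows "compact_space X"
proof (rule ccontr)
  assume "\<not> compact_space X"
  then obtain \<U> where \<U>: "\<And>U. U \<in> \<U> \<Longrightarrow> openin X U" "topspace X \<subseteq> \<Union>\<U>"
    and no: "\<And>\<F>. finite \<F> \<Longrightarrow> \<F> \<subseteq> \<U> \<Longrightarrow> \<not> topspace X \<subseteq> \<Union>\<F>"
    unfolding compact_space_def compactin_def by (metis order_refl)
  have no_countable: "\<not> topspace X \<subseteq> \<Union>\<F>" if F: "countable \<F>" "\<F> \<subseteq> \<U>" for \<F>
  proof
    assume cov: "topspace X \<subseteq> \<Union>\<F>"
    have op: "openin X U" if "U \<in> \<F>" for U
      using that F(2) \<U>(1) by blast
    obtain \<G> where G: "finite \<G>" "\<G> \<subseteq> \<F>" "topspace X \<subseteq> \<Union>\<G>"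
      by (rule limit_point_compact_countable_cover[OF lpc t1 closedin_topspace F(1) op cov])
    show False
      using no[OF G(1) order_trans[OF G(2) F(2)]] G(3) by blast
  qed
  have reg: "regular_space X"
    using pn t1 unfolding perfectly_normal_space_def by (metis normal_t1_imp_regular_space)
  have "\<exists>U. x \<in> topspace X \<longrightarrow> U \<in> \<U> \<and> x \<in> U" for x
    using \<U>(2) by blast
  then obtain U where U: "\<And>x. x \<in> topspace X \<Longrightarrow> U x \<in> \<U> \<and> x \<in> U x"
    by metis
  \<comment> \<open>Regularity shrinks \<open>U x\<close> to \<open>V x\<close> with closure inside
    \<open>U x\<close>. Covers will be given by the \<open>V x\<close>, and failures to cover will
    concern the larger \<open>U x\<close>.\<close>
  have "\<exists>V. x \<in> topspace X \<longrightarrow> openin X V \<and> x \<in> V \<and> X closure_of V \<subseteq> U x" for x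
  proof (cases "x \<in> topspace X")
    case True
    then have "closedin X (topspace X - U x)" "x \<in> topspace X - (topspace X - U x)"
      using U[OF True] \<U>(1) by blast+
    then obtain V W where VW: "openin X V" "openin X W" "x \<in> V" "topspace X - U x \<subseteq> W" "disjnt V W"
      using reg unfolding regular_space_def by meson
    have "V \<subseteq> topspace X - W"
      using VW openin_subset by (fastforce simp: disjnt_def)
    then have "X closure_of V \<subseteq> topspace X - W"
      using VW by (intro closure_of_minimal) auto
    then show ?thesis
      using VW by blast
  qed blast
  then obtain V where V: "\<And>x. x \<in> topspace X \<Longrightarrow> openin X (V x)"
    "\<And>x. x \<in> topspace X \<Longrightarrow> x \<in> V x" "\<And>x. x \<in> topspace X \<Longrightarrow> X closure_of (V x) \<subseteq> U x"
    by metis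
  obtain A :: "real set" where A: "uncountable A" "A \<prec> (UNIV :: real set)"
    using not_continuum_hypothesisE[OF CH] .
  \<comment> \<open>a right-separated sequence of type \<open>\<omega>\<^sub>1\<close>; perfectness gives a closed \<open>E\<close> inside the union of its
    neighbourhoods that still contains uncountably many of its points\<close>
  have "\<exists>L lt. L \<subseteq> topspace X \<and> uncountable L \<and> L \<lesssim> A \<and>
    (\<forall>x\<in>L. \<forall>y\<in>L. x \<noteq> y \<longrightarrow> lt x y \<or> lt y x) \<and>
    (\<forall>x\<in>L. countable {y\<in>L. lt y x} \<and> (\<forall>y\<in>{y\<in>L. lt y x}. x \<notin> U y))"
  proof (rule ex_omega1_sequence[OF A(1)])
    fix S
    assume S: "S \<subseteq> topspace X" "countable S"
    then have "U ` S \<subseteq> \<U>"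
      using U by blast
    then have "\<not> topspace X \<subseteq> \<Union>(U ` S)"
      using no_countable[of "U ` S"] S(2) by blast
    then show "\<exists>x\<in>topspace X - S. \<forall>y\<in>S. x \<notin> U y"
      using S(1) U by blast
  qed
  then obtain L lt where L: "L \<subseteq> topspace X" "uncountable L" "L \<lesssim> A"
    and tot: "\<forall>x\<in>L. \<forall>y\<in>L. x \<noteq> y \<longrightarrow> lt x y \<or> lt y x"
    and seq: "\<forall>x\<in>L. countable {y\<in>L. lt y x} \<and> (\<forall>y\<in>{y\<in>L. lt y x}. x \<notin> U y)"
    by (elim exE conjE)
  have "openin X (\<Union>(V ` L))"
    using V(1) L(1) by blast
  then obtain C :: "nat \<Rightarrow> _" where C: "\<And>n. closedin X (C n)" "\<Union>(V ` L) = (\<Union>n. C n)"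
    using perfectly_normal_open_Union_closed[OF pn] by metis
  have "L \<subseteq> (\<Union>n. L \<inter> C n)"
    using V(2) L(1) C(2) by blast
  then obtain n where n: "uncountable (L \<inter> C n)"
    using L(2) by (metis UNIV_I countableI_type countable_UN countable_subset)
  define E where "E = C n"
  have E: "closedin X E" "E \<subseteq> \<Union>(V ` L)" "uncountable (L \<inter> E)" "E \<subseteq> topspace X"
    using C n closedin_subset unfolding E_def by blast+
  \<comment> \<open>Later terms of the sequence avoid \<open>U y\<close>, so only \<open>y\<close>
    and its countably many predecessors can lie in it.\<close>
  have UL: "countable (L \<inter> U y)" if y: "y \<in> L" for y
  proof (rule countable_subset)
    show "L \<inter> U y \<subseteq> insert y {x\<in>L. lt x y}"
    proof
      fix x
      assume x: "x \<in> L \<inter> U y"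
      then have "\<not> lt y x"
        using bspec[OF seq, of x] y by blast
      then show "x \<in> insert y {x\<in>L. lt x y}"
        using tot x y by blast
    qed
    show "countable (insert y {x\<in>L. lt x y})"
      using bspec[OF seq y] by simp
  qed
  have E_no: "\<not> E \<subseteq> \<Union>(U ` M)" if M: "countable M" "M \<subseteq> L" for M
  proof
    assume "E \<subseteq> \<Union>(U ` M)"
    then have "L \<inter> E \<subseteq> (\<Union>y\<in>M. L \<inter> U y)"
      by blast
    moreover have "countable (\<Union>y\<in>M. L \<inter> U y)"
      using M UL by (intro countable_UN) auto
    ultimately show False
      using E(3) countable_subset by blast
  qed
  have VU: "V y \<subseteq> U y" if "y \<in> L" for y
  proof -
    have y: "y \<in> topspace X"
      using that L(1) by blast
    have "V y \<subseteq> X closure_of V y"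
      by (rule closure_of_subset[OF openin_subset[OF V(1)[OF y]]])
    also have "\<dots> \<subseteq> U y"
      by (rule V(3)[OF y])
    finally show ?thesis .
  qed
  have "\<exists>D. countable D \<and> D \<subseteq> E \<and>
    (\<forall>M. countable M \<and> M \<subseteq> L \<longrightarrow> \<not> X closure_of D \<subseteq> \<Union>(U ` M))"
  proof (rule ccontr)
    assume "\<not> ?thesis"
    then have cov: "\<exists>M. countable M \<and> M \<subseteq> L \<and> X closure_of D \<subseteq> \<Union>(U ` M)"
      if "countable D" "D \<subseteq> E" for D
      using that by meson
    have "\<exists>y. x \<in> E \<longrightarrow> y \<in> L \<and> x \<in> U y" for x
      using E(2) VU by blast
    then obtain h where h: "\<And>x. x \<in> E \<Longrightarrow> h x \<in> L \<and> x \<in> U (h x)"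
      by metis
    \<comment> \<open>a free sequence in \<open>E\<close>, which would be an uncountable discrete subset\<close>
    have "\<exists>K lt. K \<subseteq> E \<and> uncountable K \<and> K \<lesssim> A \<and>
      (\<forall>x\<in>K. \<forall>y\<in>K. x \<noteq> y \<longrightarrow> lt x y \<or> lt y x) \<and>
      (\<forall>x\<in>K. countable {y\<in>K. lt y x} \<and>
        (x \<notin> X closure_of {y\<in>K. lt y x} \<and> (\<forall>y\<in>{y\<in>K. lt y x}. x \<notin> U (h y))))"
    proof (rule ex_omega1_sequence[OF A(1)])
      fix S
      assume S: "S \<subseteq> E" "countable S"
      obtain M where M: "countable M" "M \<subseteq> L" "X closure_of S \<subseteq> \<Union>(U ` M)"
        using cov[OF S(2,1)] by blast
      have "countable (M \<union> h ` S)" "M \<union> h ` S \<subseteq> L"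
        using M S h by auto
      then have "\<not> E \<subseteq> \<Union>(U ` (M \<union> h ` S))"
        by (rule E_no)
      then obtain x where x: "x \<in> E" "x \<notin> \<Union>(U ` (M \<union> h ` S))"
        by blast
      have "S \<subseteq> X closure_of S"
        using S(1) E(4) by (intro closure_of_subset) blast
      then have "x \<notin> X closure_of S" "x \<notin> S"
        using M(3) x(2) by blast+
      then show "\<exists>x\<in>E - S. x \<notin> X closure_of S \<and> (\<forall>y\<in>S. x \<notin> U (h y))"
        using x by (intro bexI[of _ x]) auto
    qed
    then obtain K lt' where K: "K \<subseteq> E" "uncountable K"
      and tot': "\<forall>x\<in>K. \<forall>y\<in>K. x \<noteq> y \<longrightarrow> lt' x y \<or> lt' y x"
      and free: "\<forall>x\<in>K. countable {y\<in>K. lt' y x} \<and>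
        (x \<notin> X closure_of {y\<in>K. lt' y x} \<and> (\<forall>y\<in>{y\<in>K. lt' y x}. x \<notin> U (h y)))"
      by (elim exE conjE)
    \<comment> \<open>To isolate \<open>x\<close>, the set \<open>U (h x)\<close> excludes the later
      points and removing the closure of the predecessors excludes the earlier ones.\<close>
    have "countable K"
    proof (rule countable_discrete_subset[OF lpc t1 pn, of K "\<lambda>x. U (h x) - X closure_of {y\<in>K. lt' y x}"])
      fix x
      assume x: "x \<in> K"
      then have hx: "h x \<in> L" "x \<in> U (h x)"
        using K(1) h by blast+
      then have "openin X (U (h x))"
        using L(1) U \<U>(1) by blast
      then show "openin X (U (h x) - X closure_of {y\<in>K. lt' y x})"
        by (intro openin_diff) auto
      have sub: "{y\<in>K. lt' y x} \<subseteq> X closure_of {y\<in>K. lt' y x}"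
        using K(1) E(4) by (intro closure_of_subset) blast
      show "K \<inter> (U (h x) - X closure_of {y\<in>K. lt' y x}) = {x}"
      proof (intro equalityI subsetI)
        fix y
        assume y: "y \<in> K \<inter> (U (h x) - X closure_of {y\<in>K. lt' y x})"
        then have "\<not> lt' y x"
          using sub by blast
        moreover have "\<not> lt' x y"
          using bspec[OF free, of y] x y by blast
        ultimately show "y \<in> {x}"
          using tot' x y by blast
      qed (use x hx bspec[OF free x] in blast)
    qed
    then show False
      using K(2) by blast
  qed
  then obtain D where D: "countable D" "D \<subseteq> E"
    and D_no: "\<forall>M. countable M \<and> M \<subseteq> L \<longrightarrow> \<not> X closure_of D \<subseteq> \<Union>(U ` M)"
    by (elim exE conjE)
  have DE: "X closure_of D \<subseteq> E"
    using D(2) E(1) by (rule closure_of_minimal)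
  have DX: "D \<subseteq> topspace X" and cov: "X closure_of D \<subseteq> \<Union>(V ` L)"
    using D(2) E(2,4) DE by blast+
  have small: "L \<prec> (UNIV :: real set)"
    using L(3) A(2) by (rule lesspoll_trans1)
  have op: "openin X (V y)" if "y \<in> L" for y
    using that L(1) V(1) by blast
  obtain T where T: "finite T" "T \<subseteq> L" "X closure_of D \<subseteq> (\<Union>y\<in>T. X closure_of V y)"
    by (rule martins_axiom_separable_cover[OF MA lpc t1 small D(1) DX op cov])
  \<comment> \<open>Passing from closures of the \<open>V y\<close> to the \<open>U y\<close> gives
    a finite subfamily covering the closure of \<open>D\<close>, contrary to the choice of
    \<open>D\<close>.\<close>
  have "(\<Union>y\<in>T. X closure_of V y) \<subseteq> \<Union>(U ` T)"
    using V(3) T(2) L(1) by blast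
  then show False
    using D_no T(2,3) countable_finite[OF T(1)] by (metis subset_trans)
qed

section \<open>One-point connectifications\<close>

text \<open>The hypothesis \<open>topspace X \<noteq> {}\<close> excludes the empty space, which has
  no component at all but is not dense in a one-point space.\<close>

theorem theorem2p9:
  fixes X :: "'a topology" and i :: sep_axiom
  assumes "i \<in> {T3half, T4, T5} \<or> (i = T6 \<and> martins_axiom \<and> \<not> continuum_hypothesis)"
    and "topspace X \<noteq> {}"
    and "locally_connected_space X" and "pseudocompact_space X" and "T_space i X"
  shows "(\<exists>Y :: 'a option topology. one_point_connectification X Y \<and>
             pseudocompact_space Y \<and> T_space i Y)
         \<longleftrightarrow> \<not> (\<exists>C\<in>connected_components_of X. compactin X C)"
proof (cases "i = T6")
  case True
  have pn: "perfectly_normal_space X" and t1: "t1_space X"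
    using assms(5) True by auto
  have "limit_point_compact_space X"
    using assms(4) pn pseudocompact_normal_imp_limit_point_compact
    unfolding perfectly_normal_space_def by metis
  \<comment> \<open>The components are closed, so compactness of \<open>X\<close> makes them
    compact; both sides of the equivalence are then false.\<close>
  then have comp: "compact_space X"
    using assms(1) True pn t1 compact_space_if_martins_axiom by auto
  have "topspace X = \<Union>(connected_components_of X)"
    by (simp add: Union_connected_components_of)
  then obtain C where C: "C \<in> connected_components_of X"
    using assms(2) by auto
  then have CC: "compactin X C"
    by (simp add: closedin_compact_space closedin_connected_components_of comp)
  have "\<not> one_point_connectification X Y" if "T_space i Y" for Y :: "'a option topology"
    using not_compactin_component_of_one_point_connectification[OF assms(3) _
        T_space_imp_Hausdorff_space[OF that] C] CC by (metis (full_types))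
  then show ?thesis
    using C CC by (metis (full_types))
next
  case False
  show ?thesis
  proof
    assume "\<exists>Y :: 'a option topology. one_point_connectification X Y \<and>
      pseudocompact_space Y \<and> T_space i Y"
    then obtain Y :: "'a option topology" where Y: "one_point_connectification X Y" "T_space i Y"
      by (elim exE conjE)
    show "\<not> (\<exists>C\<in>connected_components_of X. compactin X C)"
      using not_compactin_component_of_one_point_connectification[OF assms(3) Y(1)
          T_space_imp_Hausdorff_space[OF Y(2)]] by (metis (full_types))
  next
    assume nc: "\<not> (\<exists>C\<in>connected_components_of X. compactin X C)"
    show "\<exists>Y :: 'a option topology. one_point_connectification X Y \<and>
      pseudocompact_space Y \<and> T_space i Y"
    proof (rule ex_one_point_connectification[OF False assms(2-5)])
      show "\<not> compactin X C" if "C \<in> connected_components_of X" for C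
        using nc that by (metis (full_types))
    qed
  qed
qed

end
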